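(* Let $d\ge1$, $0<\alpha\le2$, $\beta=1$ and $d<2\alpha$. Let $$\xi_t=\int_{\mathbb{R}^{d+1}}\Bigl(\mathbf 1_{[0,t]}(r)\int_r^tp_{u-r}(x)\,du\Bigr)M(dr\,dx),\quad t\ge0.$$ Then $\xi$ is a centered Gaussian process with covariance, for $s,t\ge0$, $$E\xi_s\xi_t=\frac{p_1(0)}{(1-\frac d\alpha)(2-\frac d\alpha)(3-\frac d\alpha)}\Bigl(\tfrac12\bigl[(s+t)^{3-d/\alpha}+|s-t|^{3-d/\alpha}\bigr]-s^{3-d/\alpha}-t^{3-d/\alpha}\Bigr)\quad\text{if }d\ne\alpha,$$ $$E\xi_s\xi_t=\frac{p_1(0)}{2}\Bigl(\tfrac12\bigl[(s+t)^2\log(s+t)+(s-t)^2\log|s-t|\bigr]-s^2\log s-t^2\log t\Bigr)\quad\text{if }d=\alpha.$$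
   Context: $p_t(x)$ is the transition density of the standard symmetric $\alpha$-stable Lévy process in $\mathbb{R}^d$ (characteristic function $e^{-t|z|^\alpha}$ at time $t$). $M$ is the independently scattered $(1+\beta)$-stable random measure on $\mathbb{R}^{d+1}$ (points $(r,x)$, $r\in\mathbb{R}$, $x\in\mathbb{R}^d$) with control measure $\lambda_{d+1}$ (Lebesgue measure) and skewness intensity 1, i.e., for each Borel $A$ with $0<\lambda_{d+1}(A)<\infty$, $M(A)$ is a $(1+\beta)$-stable random variable with characteristic function $\exp\{-\lambda_{d+1}(A)|z|^{1+\beta}(1-i(\mathrm{sgn}\,z)\tan\frac{\pi}{2}(1+\beta))\}$, $z\in\mathbb{R}$; the values of $M$ on disjoint sets are independent; $M$ is $\sigma$-additive a.s. Here $\beta=1$, so $M$ is Gaussian. Convention: $0^2\log0=0$.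
   Formalization: Both covariance formulas are proved with an extra factor 2 on the right-hand side, because for β=1 the stated characteristic function exp(−λ(A)z²) gives M(A) variance 2λ(A), so the formulas as printed are half the true covariance. *)

theory Defs
  imports "HOL-Probability.Probability"
begin

text \<open>
  \<open>p t\<close> is the density at time \<open>t\<close> of the standard symmetric \<open>\<alpha>\<close>-stable Levy process, whose
  characteristic function is \<open>exp (- t |z|^\<alpha>)\<close>.  The value \<open>p 1 0\<close> is meaningful only for the
  continuous version of the density, hence the continuity requirement; it makes \<open>p t\<close> unique for
  every \<open>t > 0\<close>.  Nothing is said about \<open>p t\<close> for \<open>t \<le> 0\<close>.
\<close>

definition stable_transition_density :: "real \<Rightarrow> (real \<Rightarrow> 'a::euclidean_space \<Rightarrow> real) \<Rightarrow> bool"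
  where "stable_transition_density \<alpha> p \<longleftrightarrow>
    (\<forall>t>0. continuous_on UNIV (p t) \<and> (\<forall>x. 0 \<le> p t x) \<and>
       prob_space (density lborel (\<lambda>x. ennreal (p t x))) \<and>
       (\<forall>z. (CLINT x|density lborel (\<lambda>x. ennreal (p t x)). iexp (z \<bullet> x))
              = complex_of_real (exp (- t * norm z powr \<alpha>))))"

definition finite_borel_sets :: "'e::euclidean_space set set"
  where "finite_borel_sets = {A \<in> sets borel. emeasure lborel A < \<infinity>}"

text \<open>
  The independently scattered \<open>(1+\<beta>)\<close>-stable random measure with Lebesgue control measure and
  skewness intensity 1; only the values on \<open>finite_borel_sets\<close> matter.  For \<open>\<beta> = 1\<close> the
  characteristic function of \<open>M A\<close> is \<open>exp (- \<lambda>(A) z^2)\<close>, so that \<open>M A\<close> has variance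
  \<open>2 \<lambda>(A)\<close>, not \<open>\<lambda>(A)\<close>, and the integrals of \<open>f\<close> and \<open>g\<close> have covariance
  \<open>2 \<integral> f g\<close>; hence the factor 2 in front of the covariance formulas.
\<close>

definition stable_random_measure ::
    "real \<Rightarrow> 'w measure \<Rightarrow> ('e::euclidean_space set \<Rightarrow> 'w \<Rightarrow> real) \<Rightarrow> bool"
  where "stable_random_measure \<beta> P M \<longleftrightarrow>
    prob_space P \<and>
    (\<forall>A\<in>finite_borel_sets. M A \<in> borel_measurable P) \<and>
    (\<forall>A\<in>finite_borel_sets. 0 < measure lborel A \<longrightarrow>
       (\<forall>z. char (distr P borel (M A)) z =
          exp (- complex_of_real (measure lborel A * \<bar>z\<bar> powr (1 + \<beta>)) *
               (1 - \<i> * complex_of_real (sgn z * tan (pi / 2 * (1 + \<beta>))))))) \<and>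
    (\<forall>(I :: nat set) A. finite I \<longrightarrow> A ` I \<subseteq> finite_borel_sets \<longrightarrow> disjoint_family_on A I \<longrightarrow>
       prob_space.indep_vars P (\<lambda>_. borel) (\<lambda>i. M (A i)) I) \<and>
    (\<forall>A :: nat \<Rightarrow> 'e set. range A \<subseteq> finite_borel_sets \<longrightarrow> disjoint_family A \<longrightarrow>
       (\<Union>i. A i) \<in> finite_borel_sets \<longrightarrow>
       (AE \<omega> in P. (\<lambda>i. M (A i) \<omega>) sums M (\<Union>i. A i) \<omega>))"

definition elementary_integrand :: "('e::euclidean_space \<Rightarrow> real) \<Rightarrow> bool"
  where "elementary_integrand f \<longleftrightarrow>
    simple_function borel f \<and> emeasure lborel {x. f x \<noteq> 0} < \<infinity>"

definition elementary_integral ::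
    "('e::euclidean_space set \<Rightarrow> 'w \<Rightarrow> real) \<Rightarrow> ('e \<Rightarrow> real) \<Rightarrow> 'w \<Rightarrow> real"
  where "elementary_integral M f \<omega> = (\<Sum>y\<in>range f - {0}. y * M (f -` {y}) \<omega>)"

text \<open>
  The integral of \<open>f\<close> in \<open>L^(1+\<beta>)\<close> is the limit in probability of the integrals of
  simple functions that converge to \<open>f\<close> in \<open>L^(1+\<beta>)\<close>.  It is determined up to almost
  sure equality.
\<close>

definition has_stable_integral ::
    "real \<Rightarrow> 'w measure \<Rightarrow> ('e::euclidean_space set \<Rightarrow> 'w \<Rightarrow> real) \<Rightarrow> ('e \<Rightarrow> real) \<Rightarrow> ('w \<Rightarrow> real) \<Rightarrow> bool"
  where "has_stable_integral \<beta> P M f X \<longleftrightarrow>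
    f \<in> borel_measurable borel \<and> X \<in> borel_measurable P \<and>
    (\<exists>F. (\<forall>n. elementary_integrand (F n)) \<and>
       (\<lambda>n. \<integral>\<^sup>+x. ennreal (\<bar>F n x - f x\<bar> powr (1 + \<beta>)) \<partial>lborel) \<longlonglongrightarrow> 0 \<and>
       (\<forall>\<epsilon>>0. (\<lambda>n. measure P {\<omega> \<in> space P. \<bar>elementary_integral M (F n) \<omega> - X \<omega>\<bar> > \<epsilon>})
          \<longlonglongrightarrow> 0))"

definition stable_integral ::
    "real \<Rightarrow> 'w measure \<Rightarrow> ('e::euclidean_space set \<Rightarrow> 'w \<Rightarrow> real) \<Rightarrow> ('e \<Rightarrow> real) \<Rightarrow> 'w \<Rightarrow> real"
  where "stable_integral \<beta> P M f = (SOME X. has_stable_integral \<beta> P M f X)"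

text \<open>Gaussian variables may be degenerate (a.s. constant).\<close>

definition gaussian_variable :: "'w measure \<Rightarrow> ('w \<Rightarrow> real) \<Rightarrow> bool"
  where "gaussian_variable P X \<longleftrightarrow>
    X \<in> borel_measurable P \<and>
    (\<exists>m. (AE \<omega> in P. X \<omega> = m) \<or>
         (\<exists>\<sigma>>0. distributed P lborel X (\<lambda>x. ennreal (normal_density m \<sigma> x))))"

definition centered_gaussian_process :: "'w measure \<Rightarrow> 't set \<Rightarrow> ('t \<Rightarrow> 'w \<Rightarrow> real) \<Rightarrow> bool"
  where "centered_gaussian_process P T X \<longleftrightarrow>
    (\<forall>S c. finite S \<longrightarrow> S \<subseteq> T \<longrightarrow> gaussian_variable P (\<lambda>\<omega>. \<Sum>t\<in>S. c t * X t \<omega>)) \<and>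
    (\<forall>t\<in>T. prob_space.expectation P (X t) = 0)"

text \<open>The inner integral is \<open>+\<infinity>\<close> at \<open>x = 0\<close> if \<open>d \<ge> \<alpha>\<close>, where the Bochner integral
  yields 0; this only concerns a null set.\<close>

definition xi_kernel :: "(real \<Rightarrow> 'a::euclidean_space \<Rightarrow> real) \<Rightarrow> real \<Rightarrow> real \<times> 'a \<Rightarrow> real"
  where "xi_kernel p t = (\<lambda>(r, x). indicator {0..t} r * (LBINT u=r..t. p (u - r) x))"

end

theory Submission
  imports Defs "HOL-Real_Asymp.Real_Asymp"
begin

text \<open>
  For \<open>\<beta> = 1\<close> the random measure is Gaussian and \<open>M A\<close> has variance \<open>2 \<lambda>(A)\<close>. Integrals of elementary
  functions are therefore centred normal with variance \<open>2 \<integral> f\<^sup>2\<close>, and this passes to the limit in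
  probability that defines the integral of a general square integrable \<open>f\<close> (\<open>has_stable_integral_char\<close>).
  Such integrals exist (\<open>ex_has_stable_integral\<close>) and are linear in \<open>f\<close> (\<open>has_stable_integral_lincomb\<close>).
  So finite linear combinations of the \<open>\<xi> t\<close> are again stable integrals, hence centred normal, and by
  polarization the covariance of \<open>\<xi> s\<close> and \<open>\<xi> t\<close> is twice the \<open>L\<^sup>2\<close> inner product of their kernels.

  That inner product is, by Tonelli's theorem,
  \<open>\<integral>\<^sub>0\<^sup>m \<integral>\<^sub>r\<^sup>s \<integral>\<^sub>r\<^sup>t (\<integral> p\<^sub>u\<^sub>-\<^sub>r(x) p\<^sub>v\<^sub>-\<^sub>r(x) dx) dv du dr\<close> with \<open>m = min s t\<close>. The innermost integral equals
  \<open>p\<^sub>u\<^sub>+\<^sub>v\<^sub>-\<^sub>2\<^sub>r(0)\<close> by the Chapman-Kolmogorov equation and symmetry (\<open>chapman_kolmogorov_at_0\<close>), and this is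
  \<open>(u + v - 2 r)\<^sup>-\<^sup>\<gamma> p\<^sub>1(0)\<close> with \<open>\<gamma> = d / \<alpha>\<close> by self-similarity (\<open>p_at_0\<close>). Three elementary integrations give
  the result; \<open>\<gamma> < 2\<close> makes the singularity at \<open>u = v = r\<close> integrable, and \<open>\<gamma> = 1\<close> produces
  the logarithms.

  The two facts about the density, and its joint measurability in time and space, are read off from Fourier
  inversion in \<open>\<real>\<^sup>d\<close> (\<open>fourier_inversion\<close>). This is proved by convolving with Gaussian densities
  and letting their width tend to \<open>0\<close>.
\<close>

section \<open>Iterated integrals of functions with known primitives\<close>

text \<open>
  The derivative may be unbounded at the endpoints: only the primitive has to be continuous there.
  This is the situation for \<open>x powr - \<gamma>\<close> near \<open>0\<close>.
\<close>

lemma nn_integral_FTC_Ioo: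
  fixes f F :: "real \<Rightarrow> real"
  assumes "a \<le> b"
    and D: "\<And>x. a < x \<Longrightarrow> x < b \<Longrightarrow> (F has_real_derivative f x) (at x)"
    and C: "\<And>x. a < x \<Longrightarrow> x < b \<Longrightarrow> isCont f x"
    and nonneg: "\<And>x. a < x \<Longrightarrow> x < b \<Longrightarrow> 0 \<le> f x"
    and F: "continuous_on {a..b} F"
  shows "(\<integral>\<^sup>+x. ennreal (f x) * indicator {a<..<b} x \<partial>lborel) = ennreal (F b - F a)"
    and "F a \<le> F b"
proof -
  have "F a \<le> F b \<and> (\<integral>\<^sup>+x. ennreal (f x) * indicator {a<..<b} x \<partial>lborel) = ennreal (F b - F a)"
  proof (cases "a = b")
    case False
    with \<open>a \<le> b\<close> have "a < b" by simp
    have A: "((F \<circ> real_of_ereal) \<longlongrightarrow> F a) (at_right (ereal a))"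
      using F \<open>a < b\<close>
      by (simp add: ereal_tendsto_simps continuous_on_Icc_at_rightD)
    have B: "((F \<circ> real_of_ereal) \<longlongrightarrow> F b) (at_left (ereal b))"
      using F \<open>a < b\<close>
      by (simp add: ereal_tendsto_simps continuous_on_Icc_at_leftD)
    have AE: "AE x in lborel. ereal a < ereal x \<longrightarrow> ereal x < ereal b \<longrightarrow> 0 \<le> f x"
      using nonneg by auto
    have I: "set_integrable lborel (einterval a b) f" "(LBINT x=ereal a..ereal b. f x) = F b - F a"
      using interval_integral_FTC_nonneg[of "ereal a" "ereal b" F f "F a" "F b"] D C AE A B \<open>a < b\<close>
      by auto
    have nn: "0 \<le> (LBINT x:einterval a b. f x)"
      unfolding set_lebesgue_integral_def
      using nonneg by (intro Bochner_Integration.integral_nonneg_AE) (auto simp: indicator_def)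
    have "(\<integral>\<^sup>+x. ennreal (f x) * indicator {a<..<b} x \<partial>lborel)
        = (\<integral>\<^sup>+x. ennreal (indicator (einterval a b) x *\<^sub>R f x) \<partial>lborel)"
      by (intro nn_integral_cong) (auto simp: indicator_def)
    also have "\<dots> = ennreal (LBINT x:einterval a b. f x)"
      unfolding set_lebesgue_integral_def using I(1) nonneg
      by (intro nn_integral_eq_integral) (auto simp: set_integrable_def indicator_def)
    also have "(LBINT x:einterval a b. f x) = F b - F a"
      using I(2) \<open>a < b\<close> by (simp add: interval_lebesgue_integral_def)
    finally show ?thesis
      using nn I(2) \<open>a < b\<close> by (simp add: interval_lebesgue_integral_def)
  qed simp
  then show "(\<integral>\<^sup>+x. ennreal (f x) * indicator {a<..<b} x \<partial>lborel) = ennreal (F b - F a)"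
    and "F a \<le> F b" by auto
qed

text \<open>
  A nonnegative function on the positive half-line with three successive primitives, of which the second
  and third extend continuously to \<open>0\<close> with value \<open>0\<close>. The first primitive may blow up at \<open>0\<close>. Integrals of
  \<open>\<phi>0 (a + b)\<close> are then boundary values of \<open>\<phi>2\<close> and \<open>\<phi>3\<close>, so that the exponents \<open>\<gamma> \<noteq> 1\<close> and the
  logarithmic case \<open>\<gamma> = 1\<close> of \<open>\<phi>0 x = x powr - \<gamma>\<close> need no separate integration.
\<close>

locale iterated_primitives =
  fixes \<phi>0 \<phi>1 \<phi>2 \<phi>3 :: "real \<Rightarrow> real"
  assumes D1: "\<And>x. 0 < x \<Longrightarrow> (\<phi>1 has_real_derivative \<phi>0 x) (at x)"
    and D2: "\<And>x. 0 < x \<Longrightarrow> (\<phi>2 has_real_derivative \<phi>1 x) (at x)"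
    and D3: "\<And>x. 0 < x \<Longrightarrow> (\<phi>3 has_real_derivative \<phi>2 x) (at x)"
    and C0: "\<And>x. 0 < x \<Longrightarrow> isCont \<phi>0 x"
    and nonneg: "\<And>x. 0 < x \<Longrightarrow> 0 \<le> \<phi>0 x"
    and C2: "continuous_on {0..} \<phi>2"
    and C3: "continuous_on {0..} \<phi>3"
    and zero2: "\<phi>2 0 = 0"
    and zero3: "\<phi>3 0 = 0"
begin

lemma cont2: "0 < x \<Longrightarrow> isCont \<phi>2 x"
  using D2 DERIV_isCont by blast

lemma D1_shift: "0 < c + x \<Longrightarrow> ((\<lambda>x. \<phi>1 (c + x)) has_real_derivative \<phi>0 (c + x)) (at x)"
  by (rule DERIV_chain2[OF D1, THEN DERIV_cong]) (auto intro!: derivative_eq_intros)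

lemma D2_shift: "0 < c + x \<Longrightarrow> ((\<lambda>x. \<phi>2 (c + x)) has_real_derivative \<phi>1 (c + x)) (at x)"
  by (rule DERIV_chain2[OF D2, THEN DERIV_cong]) (auto intro!: derivative_eq_intros)

lemma inner_integral:
  assumes "0 < a" "0 \<le> T"
  shows "(\<integral>\<^sup>+b. ennreal (\<phi>0 (a + b)) * indicator {0<..<T} b \<partial>lborel) = ennreal (\<phi>1 (a + T) - \<phi>1 a)"
    and "\<phi>1 a \<le> \<phi>1 (a + T)"
proof -
  have c: "continuous_on {0..T} (\<lambda>b. \<phi>1 (a + b))"
    using assms by (intro DERIV_continuous_on[where D="\<lambda>b. \<phi>0 (a + b)"]
        DERIV_subset[OF D1_shift]) auto
  have c0: "isCont (\<lambda>b. \<phi>0 (a + b)) x" if "0 < x" for x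
    using assms that by (auto intro!: isCont_o2[where g=\<phi>0, OF _ C0])
  have D: "((\<lambda>b. \<phi>1 (a + b)) has_real_derivative \<phi>0 (a + x)) (at x)" if "0 < x" for x
    using assms that by (intro D1_shift) auto
  have nn: "0 \<le> \<phi>0 (a + x)" if "0 < x" for x
    using assms that by (intro nonneg) auto
  note F = nn_integral_FTC_Ioo[OF assms(2) D c0 nn c]
  show "(\<integral>\<^sup>+b. ennreal (\<phi>0 (a + b)) * indicator {0<..<T} b \<partial>lborel) = ennreal (\<phi>1 (a + T) - \<phi>1 a)"
    using F(1) by simp
  show "\<phi>1 a \<le> \<phi>1 (a + T)"
    using F(2) by simp
qed

lemma double_integral:
  assumes "0 \<le> S" "0 \<le> T"
  shows "(\<integral>\<^sup>+a. (\<integral>\<^sup>+b. ennreal (\<phi>0 (a + b)) * indicator {0<..<T} b \<partial>lborel) * indicator {0<..<S} a \<partial>lborel)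
      = ennreal (\<phi>2 (S + T) - \<phi>2 S - \<phi>2 T)"
    and "0 \<le> \<phi>2 (S + T) - \<phi>2 S - \<phi>2 T"
proof -
  let ?F = "\<lambda>a. \<phi>2 (T + a) - \<phi>2 a" and ?f = "\<lambda>a. \<phi>1 (T + a) - \<phi>1 a"
  have D: "(?F has_real_derivative ?f x) (at x)" if "0 < x" for x
    using that assms by (intro DERIV_diff D2_shift D2) auto
  have c1: "isCont ?f x" if "0 < x" for x
    by (rule DERIV_isCont[OF DERIV_diff[OF D1_shift D1]]) (use that assms in auto)
  have nn: "0 \<le> ?f x" if "0 < x" for x
    using inner_integral(2)[of x T] that assms by (simp add: add.commute)
  have C: "continuous_on {0..S} ?F"
    by (rule continuous_on_diff[OF continuous_on_compose2[OF C2] continuous_on_subset[OF C2]])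
      (use assms in \<open>auto intro!: continuous_intros\<close>)
  note F = nn_integral_FTC_Ioo[OF assms(1) D c1 nn C, simplified]
  have "(\<integral>\<^sup>+a. (\<integral>\<^sup>+b. ennreal (\<phi>0 (a + b)) * indicator {0<..<T} b \<partial>lborel) * indicator {0<..<S} a \<partial>lborel)
     = (\<integral>\<^sup>+a. ennreal (?f a) * indicator {0<..<S} a \<partial>lborel)"
    using inner_integral(1)[of _ T] assms by (intro nn_integral_cong) (auto simp: indicator_def add.commute)
  also have "\<dots> = ennreal (\<phi>2 (S + T) - \<phi>2 S - \<phi>2 T)"
    using F(1) by (simp add: zero2 algebra_simps)
  finally show "(\<integral>\<^sup>+a. (\<integral>\<^sup>+b. ennreal (\<phi>0 (a + b)) * indicator {0<..<T} b \<partial>lborel) * indicator {0<..<S} a \<partial>lborel)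
      = ennreal (\<phi>2 (S + T) - \<phi>2 S - \<phi>2 T)" .
  show "0 \<le> \<phi>2 (S + T) - \<phi>2 S - \<phi>2 T"
    using F(2) by (simp add: zero2 algebra_simps)
qed

lemma D3_comp:
  assumes "(g has_real_derivative g') (at x)" "0 < g x"
  shows "((\<lambda>x. \<phi>3 (g x)) has_real_derivative \<phi>2 (g x) * g') (at x)"
  by (rule DERIV_chain2[OF D3[OF assms(2)] assms(1)])

lemma triple_integral:
  assumes "0 \<le> s" "0 \<le> t"
  shows "(\<integral>\<^sup>+r. ennreal (\<phi>2 (s + t - 2 * r) - \<phi>2 (s - r) - \<phi>2 (t - r)) * indicator {0<..<min s t} r \<partial>lborel)
      = ennreal (1 / 2 * (\<phi>3 (s + t) + \<phi>3 \<bar>s - t\<bar>) - \<phi>3 s - \<phi>3 t)"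
    and "0 \<le> 1 / 2 * (\<phi>3 (s + t) + \<phi>3 \<bar>s - t\<bar>) - \<phi>3 s - \<phi>3 t"
proof -
  let ?m = "min s t"
  let ?F = "\<lambda>r. - (1 / 2 * \<phi>3 (s + t - 2 * r)) + \<phi>3 (s - r) + \<phi>3 (t - r)"
  let ?f = "\<lambda>r. \<phi>2 (s + t - 2 * r) - \<phi>2 (s - r) - \<phi>2 (t - r)"
  have m: "0 \<le> ?m" using assms by simp
  have D: "(?F has_real_derivative ?f x) (at x)" if "0 < x" "x < ?m" for x
  proof -
    have d: "((\<lambda>r. s + t - 2 * r) has_real_derivative - 2) (at x)"
      "((\<lambda>r. s - r) has_real_derivative - 1) (at x)" "((\<lambda>r. t - r) has_real_derivative - 1) (at x)"
      by (auto intro!: derivative_eq_intros)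
    show ?thesis
      by (rule DERIV_cong, rule DERIV_add[OF DERIV_add[OF DERIV_minus[OF DERIV_cmult[OF D3_comp[OF d(1)]]]
              D3_comp[OF d(2)]] D3_comp[OF d(3)]]) (use that in auto)
  qed
  have c: "isCont ?f x" if "0 < x" "x < ?m" for x
    by (rule continuous_diff[OF continuous_diff[OF isCont_o2[OF _ cont2] isCont_o2[OF _ cont2]] isCont_o2[OF _ cont2]])
      (use that in \<open>auto intro!: continuous_intros\<close>)
  have nn: "0 \<le> ?f x" if "0 < x" "x < ?m" for x
    using double_integral(2)[of "s - x" "t - x"] that by (auto simp: algebra_simps)
  have C: "continuous_on {0..?m} ?F"
    by (intro continuous_on_add continuous_on_minus continuous_on_mult continuous_on_const
          continuous_on_compose2[OF C3]; use assms in \<open>auto intro!: continuous_intros\<close>)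
  \<comment> \<open>At the upper endpoint one of s - r and t - r vanishes and the other two arguments equal |s - t|.\<close>
  have V: "?F ?m - ?F 0 = 1 / 2 * (\<phi>3 (s + t) + \<phi>3 \<bar>s - t\<bar>) - \<phi>3 s - \<phi>3 t"
    by (cases "s \<le> t") (auto simp: zero3 min_def field_simps)
  have "(\<integral>\<^sup>+r. ennreal (?f r) * indicator {0<..<?m} r \<partial>lborel) = ennreal (?F ?m - ?F 0)"
    by (rule nn_integral_FTC_Ioo(1)[OF m D c nn C])
  then show "(\<integral>\<^sup>+r. ennreal (?f r) * indicator {0<..<min s t} r \<partial>lborel)
      = ennreal (1 / 2 * (\<phi>3 (s + t) + \<phi>3 \<bar>s - t\<bar>) - \<phi>3 s - \<phi>3 t)"
    unfolding V .
  have "?F 0 \<le> ?F ?m"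
    by (rule nn_integral_FTC_Ioo(2)[OF m D c nn C])
  then show "0 \<le> 1 / 2 * (\<phi>3 (s + t) + \<phi>3 \<bar>s - t\<bar>) - \<phi>3 s - \<phi>3 t"
    using V by linarith
qed

end

lemma iterated_primitives_powr:
  fixes \<gamma> :: real
  assumes "\<gamma> < 2" "\<gamma> \<noteq> 1"
  shows "iterated_primitives (\<lambda>x. x powr - \<gamma>) (\<lambda>x. x powr (1 - \<gamma>) / (1 - \<gamma>))
     (\<lambda>x. x powr (2 - \<gamma>) / ((1 - \<gamma>) * (2 - \<gamma>)))
     (\<lambda>x. x powr (3 - \<gamma>) / ((1 - \<gamma>) * (2 - \<gamma>) * (3 - \<gamma>)))"
proof
  show "continuous_on {0..} (\<lambda>x. x powr (2 - \<gamma>) / ((1 - \<gamma>) * (2 - \<gamma>)))"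
    using assms by (intro continuous_intros continuous_on_powr') auto
  show "continuous_on {0..} (\<lambda>x. x powr (3 - \<gamma>) / ((1 - \<gamma>) * (2 - \<gamma>) * (3 - \<gamma>)))"
    using assms by (intro continuous_intros continuous_on_powr') auto
  fix x :: real assume x: "0 < x"
  show "((\<lambda>x. x powr (1 - \<gamma>) / (1 - \<gamma>)) has_real_derivative x powr - \<gamma>) (at x)"
    by (rule DERIV_cong, rule DERIV_cdivide, rule has_real_derivative_powr[OF x]) (use assms in simp)
  show "((\<lambda>x. x powr (2 - \<gamma>) / ((1 - \<gamma>) * (2 - \<gamma>))) has_real_derivative x powr (1 - \<gamma>) / (1 - \<gamma>)) (at x)"
    by (rule DERIV_cong, rule DERIV_cdivide, rule has_real_derivative_powr[OF x]) (use assms in simp)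
  show "((\<lambda>x. x powr (3 - \<gamma>) / ((1 - \<gamma>) * (2 - \<gamma>) * (3 - \<gamma>))) has_real_derivative
      x powr (2 - \<gamma>) / ((1 - \<gamma>) * (2 - \<gamma>))) (at x)"
    by (rule DERIV_cong, rule DERIV_cdivide, rule has_real_derivative_powr[OF x]) (use assms in simp)
  show "isCont (\<lambda>x. x powr - \<gamma>) x"
    using x by (intro continuous_intros) auto
  show "0 \<le> x powr - \<gamma>" by simp
qed simp_all

lemma tendsto_power_mult_ln_0: "0 < n \<Longrightarrow> ((\<lambda>x::real. x ^ n * ln x) \<longlongrightarrow> 0) (at_right 0)"
  by (cases n) (auto, real_asymp)

text \<open>
  The linear and quadratic corrections make the derivatives come out; the quadratic one cancels in
  the covariance because \<open>((s + t)\<^sup>2 + (s - t)\<^sup>2) / 2 = s\<^sup>2 + t\<^sup>2\<close>.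
\<close>

lemma iterated_primitives_ln:
  "iterated_primitives (\<lambda>x. x powr - 1) ln (\<lambda>x. x * ln x - x) (\<lambda>x. x\<^sup>2 / 2 * ln x - 3 / 4 * x\<^sup>2)"
proof
  have *: "continuous_on {0..} (\<lambda>x::real. x ^ n * ln x)" if "0 < n" for n :: nat
    unfolding continuous_on_def
  proof (intro ballI)
    fix x :: real assume "x \<in> {0..}"
    then have "0 \<le> x" by simp
    show "((\<lambda>x. x ^ n * ln x) \<longlongrightarrow> x ^ n * ln x) (at x within {0..})"
    proof (cases "x = 0")
      case True
      then show ?thesis
        using tendsto_power_mult_ln_0[OF that] that
        by (simp add: at_within_Ici_at_right)
    next
      case False
      then show ?thesis using \<open>0 \<le> x\<close>
        by (intro tendsto_intros) auto
    qed
  qed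
  show "continuous_on {0..} (\<lambda>x::real. x * ln x - x)"
    using continuous_on_diff[OF *[of 1] continuous_on_id] by simp
  show "continuous_on {0..} (\<lambda>x::real. x\<^sup>2 / 2 * ln x - 3 / 4 * x\<^sup>2)"
    using continuous_on_diff[OF continuous_on_divide[OF *[of 2] continuous_on_const[of _ 2]]
        continuous_on_mult[OF continuous_on_const[of _ "3 / 4"] continuous_on_power[OF continuous_on_id, of _ 2]]]
    by simp
  fix x :: real assume x: "0 < x"
  show "(ln has_real_derivative x powr - 1) (at x)"
    using x by (auto intro!: derivative_eq_intros simp: powr_minus field_simps)
  show "((\<lambda>x. x * ln x - x) has_real_derivative ln x) (at x)"
    using x by (auto intro!: derivative_eq_intros)
  show "((\<lambda>x. x\<^sup>2 / 2 * ln x - 3 / 4 * x\<^sup>2) has_real_derivative x * ln x - x) (at x)"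
    using x by (auto intro!: derivative_eq_intros simp: field_simps power2_eq_square)
  show "isCont (\<lambda>x. x powr - 1) x"
    using x by (intro continuous_intros) auto
  show "0 \<le> x powr - 1" by simp
qed simp_all

section \<open>The Fourier transform of the Gaussian kernel\<close>

lemma
  fixes f :: "'a::euclidean_space \<Rightarrow> real \<Rightarrow> 'b::{real_normed_field,banach,second_countable_topology}"
  assumes f: "\<And>b. b \<in> Basis \<Longrightarrow> integrable lborel (f b)"
  shows integral_lborel_prod: "(\<integral>x. (\<Prod>b\<in>Basis. f b (x \<bullet> b)) \<partial>lborel) = (\<Prod>b\<in>Basis. \<integral>x. f b x \<partial>lborel)"
    and integrable_lborel_prod: "integrable lborel (\<lambda>x. \<Prod>b\<in>Basis. f b (x \<bullet> b))"
proof -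
  interpret product_sigma_finite "\<lambda>_::'a. lborel :: real measure"
    by unfold_locales
  have [measurable]: "f b \<in> borel_measurable borel" if "b \<in> Basis" for b
    using f[OF that] borel_measurable_integrable by auto
  have T: "(\<lambda>g. \<Sum>b\<in>Basis. g b *\<^sub>R b) \<in> (\<Pi>\<^sub>M b\<in>(Basis::'a set). (lborel::real measure)) \<rightarrow>\<^sub>M borel"
    by measurable
  have F: "(\<lambda>x. \<Prod>b\<in>Basis. f b (x \<bullet> b)) \<in> borel_measurable borel"
    by measurable
  have eq: "(\<Prod>b\<in>Basis. f b ((\<Sum>c\<in>Basis. g c *\<^sub>R c) \<bullet> b)) = (\<Prod>b\<in>Basis. f b (g b))" for g
    by (intro prod.cong refl) simp
  show "(\<integral>x. (\<Prod>b\<in>Basis. f b (x \<bullet> b)) \<partial>lborel) = (\<Prod>b\<in>Basis. \<integral>x. f b x \<partial>lborel)"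
    by (subst lborel_eq, subst integral_distr[OF T F]) (simp add: eq product_integral_prod f)
  show "integrable lborel (\<lambda>x. \<Prod>b\<in>Basis. f b (x \<bullet> b))"
    by (subst lborel_eq, subst integrable_distr_eq[OF T F]) (simp add: eq product_integrable_prod f)
qed

text \<open>
  The density of the centred normal law with covariance matrix \<open>\<sigma>\<^sup>2\<close> times the identity.
\<close>

definition gauss :: "real \<Rightarrow> 'a::euclidean_space \<Rightarrow> real"
  where "gauss \<sigma> x = (1 / sqrt (2 * pi * \<sigma>\<^sup>2)) ^ DIM('a) * exp (- (norm x)\<^sup>2 / (2 * \<sigma>\<^sup>2))"

lemma gauss_nonneg: "0 \<le> gauss \<sigma> x"
  by (simp add: gauss_def)

lemma borel_measurable_gauss [measurable]: "gauss \<sigma> \<in> borel_measurable borel"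
  by (simp add: gauss_def[abs_def])

lemma norm_sq_eq_sum_Basis: "(norm (x::'a::euclidean_space))\<^sup>2 = (\<Sum>b\<in>Basis. (x \<bullet> b)\<^sup>2)"
  by (subst euclidean_inner[of x x, folded power2_norm_eq_inner]) (simp add: power2_eq_square)

lemma gauss_eq_prod: "gauss \<sigma> x = (\<Prod>b\<in>Basis. normal_density 0 \<sigma> (x \<bullet> b))"
proof -
  have "exp (- (norm x)\<^sup>2 / (2 * \<sigma>\<^sup>2)) = exp (\<Sum>b\<in>Basis. - (x \<bullet> b - 0)\<^sup>2 / (2 * \<sigma>\<^sup>2))"
    by (simp add: norm_sq_eq_sum_Basis sum_negf flip: sum_divide_distrib)
  then show ?thesis
    by (simp add: gauss_def normal_density_def prod.distrib exp_sum prod_dividef power_one_over)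
qed

text \<open>
  Rescaling by \<open>\<sigma>\<close> reduces this to the characteristic function of the standard normal distribution.
\<close>

lemma fourier_normal_density:
  assumes "0 < \<sigma>"
  shows "(\<integral>x. iexp (t * x) * complex_of_real (normal_density 0 \<sigma> x) \<partial>lborel) = complex_of_real (exp (- (\<sigma> * t)\<^sup>2 / 2))"
proof -
  have "(\<integral>x. iexp (t * x) * complex_of_real (normal_density 0 \<sigma> x) \<partial>lborel)
    = \<bar>\<sigma>\<bar> *\<^sub>R (\<integral>x. iexp (t * (0 + \<sigma> * x)) * complex_of_real (normal_density 0 \<sigma> (0 + \<sigma> * x)) \<partial>lborel)"
    using assms by (intro lborel_integral_real_affine) auto
  also have "\<dots> = (\<integral>x. \<bar>\<sigma>\<bar> *\<^sub>R (iexp (t * (0 + \<sigma> * x)) * complex_of_real (normal_density 0 \<sigma> (0 + \<sigma> * x))) \<partial>lborel)"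
    by simp
  also have "\<dots> = (\<integral>x. std_normal_density x *\<^sub>R iexp ((\<sigma> * t) * x) \<partial>lborel)"
  proof (intro Bochner_Integration.integral_cong refl)
    fix x
    have "\<bar>\<sigma>\<bar> * normal_density 0 \<sigma> (0 + \<sigma> * x) = std_normal_density x"
      using assms by (simp add: normal_density_def real_sqrt_mult field_simps power2_eq_square)
    then show "\<bar>\<sigma>\<bar> *\<^sub>R (iexp (t * (0 + \<sigma> * x)) * complex_of_real (normal_density 0 \<sigma> (0 + \<sigma> * x)))
      = std_normal_density x *\<^sub>R iexp ((\<sigma> * t) * x)"
      by (simp add: scaleR_conv_of_real ac_simps flip: of_real_mult)
  qed
  also have "\<dots> = char std_normal_distribution (\<sigma> * t)"
    unfolding char_def by (subst integral_density) auto
  finally show ?thesis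
    by (simp add: char_std_normal_distribution)
qed

lemma integrable_gauss:
  assumes "0 < \<sigma>"
  shows "integrable lborel (gauss \<sigma> :: 'a::euclidean_space \<Rightarrow> real)"
  unfolding gauss_eq_prod[abs_def] using assms
  by (intro integrable_lborel_prod) auto

lemma integral_gauss:
  assumes "0 < \<sigma>"
  shows "(\<integral>x. gauss \<sigma> (x::'a::euclidean_space) \<partial>lborel) = 1"
  unfolding gauss_eq_prod[abs_def] using assms
  by (subst integral_lborel_prod) auto

lemma fourier_gauss:
  fixes z :: "'a::euclidean_space"
  assumes "0 < \<sigma>"
  shows "(\<integral>x. iexp (z \<bullet> x) * complex_of_real (gauss \<sigma> x) \<partial>lborel) = complex_of_real (exp (- (\<sigma> * norm z)\<^sup>2 / 2))"
proof -
  have int: "integrable lborel (\<lambda>x. iexp (t * x) * complex_of_real (normal_density 0 \<sigma> x))" for t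
  proof (rule Bochner_Integration.integrable_bound)
    show "integrable lborel (normal_density 0 \<sigma>)" using assms by simp
  qed (auto simp: norm_mult)
  have "iexp (z \<bullet> x) * complex_of_real (gauss \<sigma> x)
    = (\<Prod>b\<in>Basis. iexp ((z \<bullet> b) * (x \<bullet> b)) * complex_of_real (normal_density 0 \<sigma> (x \<bullet> b)))" for x :: 'a
    unfolding gauss_eq_prod
    by (subst euclidean_inner[of z x]) (simp add: prod.distrib exp_sum sum_distrib_left)
  then have "(\<integral>x. iexp (z \<bullet> x) * complex_of_real (gauss \<sigma> x) \<partial>lborel)
    = (\<integral>x. (\<Prod>b\<in>Basis. iexp ((z \<bullet> b) * (x \<bullet> b)) * complex_of_real (normal_density 0 \<sigma> (x \<bullet> b))) \<partial>lborel)"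
    by presburger
  also have "\<dots> = (\<Prod>b\<in>Basis. \<integral>x. iexp ((z \<bullet> b) * x) * complex_of_real (normal_density 0 \<sigma> x) \<partial>lborel)"
    by (rule integral_lborel_prod[OF int])
  also have "\<dots> = (\<Prod>b\<in>Basis. complex_of_real (exp (- (\<sigma> * (z \<bullet> b))\<^sup>2 / 2)))"
    using fourier_normal_density[OF assms] by (intro prod.cong) auto
  also have "\<dots> = complex_of_real (exp (- (\<sigma> * norm z)\<^sup>2 / 2))"
    by (simp add: power_mult_distrib norm_sq_eq_sum_Basis sum_distrib_left sum_negf sum_divide_distrib
        flip: exp_sum of_real_prod)
  finally show ?thesis .
qed

text \<open>
  \<open>(2 \<pi>)\<^sup>-\<^sup>d\<close> times the Fourier transform of \<open>gauss \<sigma>\<close>, that is, the function of which \<open>gauss \<sigma>\<close> is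
  the Fourier transform.
\<close>

definition gauss_weight :: "real \<Rightarrow> 'a::euclidean_space \<Rightarrow> real"
  where "gauss_weight \<sigma> z = (1 / (2 * pi)) ^ DIM('a) * exp (- (\<sigma> * norm z)\<^sup>2 / 2)"

lemma borel_measurable_gauss_weight [measurable]: "gauss_weight \<sigma> \<in> borel_measurable borel"
  by (simp add: gauss_weight_def[abs_def])

lemma gauss_weight_nonneg: "0 \<le> gauss_weight \<sigma> z"
  by (simp add: gauss_weight_def)

text \<open>
  The Gaussian is its own Fourier transform up to inverting the scale, so inversion for it is just a
  second application of the transform.
\<close>

lemma gauss_weight_eq:
  fixes z :: "'a::euclidean_space"
  assumes "0 < \<sigma>"
  shows "gauss_weight \<sigma> z = (1 / sqrt (2 * pi * \<sigma>\<^sup>2)) ^ DIM('a) * gauss (1 / \<sigma>) z"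
proof -
  have "1 / sqrt (2 * pi * \<sigma>\<^sup>2) * (1 / sqrt (2 * pi * (1 / \<sigma>)\<^sup>2)) = 1 / (2 * pi)"
    using assms by (simp add: real_sqrt_mult real_sqrt_divide field_simps)
  then have "(1 / sqrt (2 * pi * \<sigma>\<^sup>2)) ^ DIM('a) * (1 / sqrt (2 * pi * (1 / \<sigma>)\<^sup>2)) ^ DIM('a) = (1 / (2 * pi)) ^ DIM('a)"
    by (metis power_mult_distrib)
  moreover have "- (\<sigma> * norm z)\<^sup>2 / 2 = - (norm z)\<^sup>2 / (2 * (1 / \<sigma>)\<^sup>2)"
    using assms by (simp add: field_simps power2_eq_square)
  ultimately show ?thesis
    by (simp add: gauss_weight_def gauss_def flip: mult.assoc)
qed

lemma integrable_gauss_weight: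
  assumes "0 < \<sigma>"
  shows "integrable lborel (gauss_weight \<sigma> :: 'a::euclidean_space \<Rightarrow> real)"
proof -
  have "gauss_weight \<sigma> = (\<lambda>z::'a. (1 / sqrt (2 * pi * \<sigma>\<^sup>2)) ^ DIM('a) * gauss (1 / \<sigma>) z)"
    using gauss_weight_eq[OF assms] by blast
  then show ?thesis
    using integrable_gauss[of "1 / \<sigma>"] assms by simp
qed

lemma gauss_fourier_inversion:
  fixes y :: "'a::euclidean_space"
  assumes "0 < \<sigma>"
  shows "(\<integral>z. iexp (y \<bullet> z) * complex_of_real (gauss_weight \<sigma> z) \<partial>lborel) = complex_of_real (gauss \<sigma> y)"
proof -
  have "(\<integral>z. iexp (y \<bullet> z) * complex_of_real (gauss_weight \<sigma> z) \<partial>lborel)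
    = (\<integral>z. complex_of_real ((1 / sqrt (2 * pi * \<sigma>\<^sup>2)) ^ DIM('a)) * (iexp (y \<bullet> z) * complex_of_real (gauss (1 / \<sigma>) z)) \<partial>lborel)"
    using assms by (simp add: gauss_weight_eq ac_simps)
  also have "\<dots> = complex_of_real ((1 / sqrt (2 * pi * \<sigma>\<^sup>2)) ^ DIM('a)) * complex_of_real (exp (- (1 / \<sigma> * norm y)\<^sup>2 / 2))"
    using assms by (subst integral_mult_right_zero, subst fourier_gauss) auto
  also have "\<dots> = complex_of_real (gauss \<sigma> y)"
    by (simp add: gauss_def power_divide mult.commute)
  finally show ?thesis .
qed

section \<open>Fourier inversion for densities with nonnegative characteristic function\<close>

text \<open>
  A continuous probability density whose characteristic function is real and nonnegative.
  Nonnegativity gives the integrability of the characteristic function for free, by Fatou's lemma.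
\<close>

locale positive_fourier_density =
  fixes f :: "'a::euclidean_space \<Rightarrow> real" and g :: "'a \<Rightarrow> real"
  assumes cont: "continuous_on UNIV f"
    and f_nonneg: "\<And>x. 0 \<le> f x"
    and prob: "prob_space (density lborel (\<lambda>x. ennreal (f x)))"
    and fourier: "\<And>z. (CLINT x|density lborel (\<lambda>x. ennreal (f x)). iexp (z \<bullet> x)) = complex_of_real (g z)"
    and g_borel [measurable]: "g \<in> borel_measurable borel"
    and g_nonneg: "\<And>z. 0 \<le> g z"
begin

abbreviation D :: "'a measure" where "D \<equiv> density lborel (\<lambda>x. ennreal (f x))"

lemma f_borel [measurable]: "f \<in> borel_measurable borel"
  using cont by (rule borel_measurable_continuous_onI)

lemma integrable_f: "integrable lborel f"
  and integral_f: "(\<integral>x. f x \<partial>lborel) = 1"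
proof -
  interpret prob_space D by (rule prob)
  have *: "(\<integral>\<^sup>+x. ennreal (f x) \<partial>lborel) = 1"
    using emeasure_space_1 by (simp add: emeasure_density)
  then show "integrable lborel f"
    using f_nonneg by (intro integrableI_nonneg) auto
  show "(\<integral>x. f x \<partial>lborel) = 1"
    using * f_nonneg by (subst integral_eq_nn_integral) auto
qed

lemma integral_D:
  fixes h :: "'a \<Rightarrow> 'b::{banach,second_countable_topology}"
  assumes "h \<in> borel_measurable borel"
  shows "integral\<^sup>L D h = (\<integral>x. f x *\<^sub>R h x \<partial>lborel)"
  using assms f_nonneg by (intro integral_density) auto

lemma g_le_1: "g z \<le> 1"
proof -
  interpret prob_space D by (rule prob)
  have "\<bar>g z\<bar> = norm (CLINT x|D. iexp (z \<bullet> x))"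
    by (simp add: fourier)
  also have "\<dots> \<le> (\<integral>x. norm (iexp (z \<bullet> x)) \<partial>D)"
    by (rule integral_norm_bound)
  also have "\<dots> = 1" using prob_space by simp
  finally show ?thesis by simp
qed

text \<open>
  Exchanging the integrals is allowed since the integrand is dominated by \<open>|h z|\<close> and \<open>f\<close> has
  mass \<open>1\<close>. The instance \<open>h = gauss_weight \<sigma>\<close> expresses mollifications of \<open>f\<close> by \<open>g\<close>; taking for
  \<open>h\<close> a multiple of another characteristic function gives the inner product of two densities.
\<close>

lemma parseval:
  fixes h :: "'a \<Rightarrow> real"
  assumes h: "integrable lborel h"
  shows "(CLINT x|D. (\<integral>z. iexp ((x - y) \<bullet> z) * complex_of_real (h z) \<partial>lborel))
    = (\<integral>z. iexp (- (y \<bullet> z)) * complex_of_real (g z * h z) \<partial>lborel)"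
proof -
  interpret prob_space D by (rule prob)
  interpret pair_sigma_finite D "lborel :: 'a measure"
    by unfold_locales
  have [measurable]: "h \<in> borel_measurable borel"
    using h borel_measurable_integrable by auto
  let ?F = "\<lambda>x z. iexp ((x - y) \<bullet> z) * complex_of_real (h z)"
  have meas[measurable]: "(\<lambda>(x, z). ?F x z) \<in> borel_measurable (D \<Otimes>\<^sub>M lborel)"
    unfolding measurable_split_conv by measurable
  have "integrable (D \<Otimes>\<^sub>M lborel) (\<lambda>(x, z). ?F x z)"
  proof (rule Fubini_integrable[OF meas])
    show "integrable D (\<lambda>x. \<integral>z. norm (case (x, z) of (x, z) \<Rightarrow> ?F x z) \<partial>lborel)"
      by (simp add: norm_mult)
    show "AE x in D. integrable lborel (\<lambda>z. case (x, z) of (x, z) \<Rightarrow> ?F x z)"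
      by (rule AE_I2, rule Bochner_Integration.integrable_bound[OF h]) (auto simp: norm_mult)
  qed
  from Fubini_integral[OF this]
  have "(CLINT x|D. (\<integral>z. ?F x z \<partial>lborel)) = (\<integral>z. (CLINT x|D. ?F x z) \<partial>lborel)"
    by simp
  also have "\<dots> = (\<integral>z. iexp (- (y \<bullet> z)) * complex_of_real (g z * h z) \<partial>lborel)"
  proof (intro Bochner_Integration.integral_cong refl)
    fix z
    have "(CLINT x|D. ?F x z) = (CLINT x|D. (iexp (- (y \<bullet> z)) * complex_of_real (h z)) * iexp (z \<bullet> x))"
      by (intro Bochner_Integration.integral_cong refl)
        (simp add: inner_diff_left algebra_simps exp_add exp_diff exp_minus field_simps inner_commute)
    also have "\<dots> = (iexp (- (y \<bullet> z)) * complex_of_real (h z)) * complex_of_real (g z)"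
      using fourier[of z] by simp
    finally show "(CLINT x|D. ?F x z) = iexp (- (y \<bullet> z)) * complex_of_real (g z * h z)"
      by (simp add: ac_simps)
  qed
  finally show ?thesis .
qed

lemma smoothed_inversion:
  assumes "0 < \<sigma>"
  shows "complex_of_real (\<integral>x. f x * gauss \<sigma> (x - y) \<partial>lborel)
    = (\<integral>z. iexp (- (y \<bullet> z)) * complex_of_real (g z * gauss_weight \<sigma> z) \<partial>lborel)"
proof -
  have "complex_of_real (\<integral>x. f x * gauss \<sigma> (x - y) \<partial>lborel) = (CLINT x|D. complex_of_real (gauss \<sigma> (x - y)))"
    by (simp add: integral_D scaleR_conv_of_real flip: integral_complex_of_real)
  also have "\<dots> = (\<integral>z. iexp (- (y \<bullet> z)) * complex_of_real (g z * gauss_weight \<sigma> z) \<partial>lborel)"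
    using parseval[OF integrable_gauss_weight[OF assms], of y]
    by (simp add: gauss_fourier_inversion[OF assms])
  finally show ?thesis .
qed

lemma gauss_scale: "0 < \<sigma> \<Longrightarrow> \<sigma> ^ DIM('a) * gauss \<sigma> (\<sigma> *\<^sub>R w) = gauss 1 (w::'a)"
  by (simp add: gauss_def real_sqrt_mult power_mult_distrib power_divide)

text \<open>
  The supremum of \<open>gauss (1 / Suc n)\<close> outside a ball around \<open>0\<close> tends to \<open>0\<close>.
\<close>

lemma gauss_far:
  assumes "0 < \<delta>"
  shows "(\<lambda>n. (1 / sqrt (2 * pi * (1 / Suc n)\<^sup>2)) ^ DIM('a) * exp (- \<delta>\<^sup>2 / (2 * (1 / Suc n)\<^sup>2))) \<longlonglongrightarrow> 0"
proof -
  have "(\<lambda>n. (1 / sqrt (2 * pi)) ^ DIM('a) * (real (Suc n) ^ DIM('a) * exp (- (\<delta>\<^sup>2 / 2) * real (Suc n) ^ 2))) \<longlonglongrightarrow> (1 / sqrt (2 * pi)) ^ DIM('a) * 0"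
    using assms by (intro tendsto_mult tendsto_const) real_asymp
  then show ?thesis
    by (simp add: real_sqrt_mult power_divide power_mult_distrib real_sqrt_divide)
qed

text \<open>
  Since \<open>f\<close> is not known to be bounded, it is split at a small ball around \<open>y\<close>. Inside the ball \<open>f\<close> is
  bounded by continuity, and dominated convergence applies after rescaling the Gaussian to \<open>\<sigma> = 1\<close>.
  Outside the ball the Gaussian itself is uniformly small and \<open>f\<close> has mass at most \<open>1\<close>.
\<close>

lemma mollification_tendsto:
  "(\<lambda>n. \<integral>x. f x * gauss (1 / Suc n) (x - y) \<partial>lborel) \<longlonglongrightarrow> f y"
proof -
  have "isCont f y" using cont by (simp add: continuous_on_eq_continuous_at)
  then obtain \<delta> where \<delta>: "0 < \<delta>" "\<And>x. dist x y < \<delta> \<Longrightarrow> dist (f x) (f y) < 1"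
    unfolding continuous_at_eps_delta by (metis zero_less_one)
  let ?s = "\<lambda>n. 1 / real (Suc n)"
  let ?n = "\<lambda>x. indicator (ball y \<delta>) x * f x"
  let ?b = "\<lambda>x. indicator (- ball y \<delta>) x * f x"
  let ?C = "\<lambda>n. (1 / sqrt (2 * pi * (?s n)\<^sup>2)) ^ DIM('a) * exp (- \<delta>\<^sup>2 / (2 * (?s n)\<^sup>2))"
  have [measurable]: "ball y \<delta> \<in> sets borel" by simp
  have bound_n: "\<bar>?n x\<bar> \<le> f y + 1" for x
    using \<delta>(2)[of x] f_nonneg[of x] f_nonneg[of y]
    by (auto simp: indicator_def dist_real_def dist_commute)
  have int_g: "integrable lborel (\<lambda>x. gauss (?s n) (x - y))" for n
  proof -
    have "integrable (distr lborel borel ((+) (- y))) (gauss (?s n) :: 'a \<Rightarrow> real)"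
      unfolding lborel_distr_plus by (rule integrable_gauss) simp
    then show ?thesis
      by (subst (asm) integrable_distr_eq) auto
  qed
  have int_n: "integrable lborel (\<lambda>x. ?n x * gauss (?s n) (x - y))" for n
  proof (rule Bochner_Integration.integrable_bound)
    show "integrable lborel (\<lambda>x. (f y + 1) * gauss (?s n) (x - y))"
      using int_g by simp
    show "AE x in lborel. norm (?n x * gauss (?s n) (x - y)) \<le> norm ((f y + 1) * gauss (?s n) (x - y))"
      using bound_n f_nonneg[of y] by (auto simp: abs_mult gauss_nonneg intro!: mult_right_mono)
  qed measurable
  have bound_b: "norm (?b x * gauss (?s n) (x - y)) \<le> ?C n * f x" for x n
  proof (cases "x \<in> ball y \<delta>")
    case True
    then show ?thesis using f_nonneg[of x] by simp
  next
    case False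
    then have "\<delta>\<^sup>2 \<le> (norm (x - y))\<^sup>2"
      using \<delta>(1) by (intro power_mono) (auto simp: dist_norm norm_minus_commute)
    then have "gauss (?s n) (x - y) \<le> ?C n"
      unfolding gauss_def by (intro mult_left_mono) (auto intro!: divide_right_mono)
    then show ?thesis
      using False mult_right_mono[OF _ f_nonneg[of x]] f_nonneg[of x]
      by (simp add: abs_mult gauss_nonneg mult.commute[of "f x"])
  qed
  have int_b: "integrable lborel (\<lambda>x. ?b x * gauss (?s n) (x - y))" for n
  proof (rule Bochner_Integration.integrable_bound)
    show "integrable lborel (\<lambda>x. ?C n * f x)"
      using integrable_f by simp
    show "AE x in lborel. norm (?b x * gauss (?s n) (x - y)) \<le> norm (?C n * f x)"
      by (intro AE_I2 order_trans[OF bound_b]) (simp only: real_norm_def abs_ge_self)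
  qed measurable
  have lim_n: "(\<lambda>n. \<integral>x. ?n x * gauss (?s n) (x - y) \<partial>lborel) \<longlonglongrightarrow> f y"
  proof -
    have "(\<integral>x. ?n x * gauss (?s n) (x - y) \<partial>lborel) = (\<integral>w. ?n (y + ?s n *\<^sub>R w) * gauss 1 w \<partial>lborel)" for n
    proof -
      have "(\<integral>x. ?n x * gauss (?s n) (x - y) \<partial>lborel)
        = (\<integral>x. ?n x * gauss (?s n) (x - y) \<partial>density (distr lborel borel (\<lambda>w. y + ?s n *\<^sub>R w)) (\<lambda>_. \<bar>?s n\<bar>^DIM('a)))"
        by (subst lborel_affine[of "?s n" y]) auto
      also have "\<dots> = (\<integral>w. \<bar>?s n\<bar>^DIM('a) * (?n (y + ?s n *\<^sub>R w) * gauss (?s n) (?s n *\<^sub>R w)) \<partial>lborel)"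
        by (subst integral_density) (auto simp: integral_distr)
      also have "\<dots> = (\<integral>w. ?n (y + ?s n *\<^sub>R w) * gauss 1 w \<partial>lborel)"
        using gauss_scale[of "?s n"] by (intro Bochner_Integration.integral_cong refl) (simp add: ac_simps)
      finally show ?thesis .
    qed
    moreover have "(\<lambda>n. \<integral>w. ?n (y + ?s n *\<^sub>R w) * gauss 1 w \<partial>lborel) \<longlonglongrightarrow> (\<integral>w. f y * gauss 1 (w::'a) \<partial>lborel)"
    proof (rule integral_dominated_convergence)
      show "integrable lborel (\<lambda>w. (f y + 1) * gauss 1 (w::'a))"
        by (intro integrable_mult_right integrable_gauss) simp
      show "AE w in lborel. norm (?n (y + ?s n *\<^sub>R w) * gauss 1 w) \<le> (f y + 1) * gauss 1 w" for n
        using bound_n[of "y + ?s n *\<^sub>R _"] by (auto simp: abs_mult gauss_nonneg intro!: mult_right_mono)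
      show "AE w in lborel. (\<lambda>n. ?n (y + ?s n *\<^sub>R w) * gauss 1 w) \<longlonglongrightarrow> f y * gauss 1 w"
      proof (rule AE_I2)
        fix w :: 'a
        have lim: "(\<lambda>n. y + ?s n *\<^sub>R w) \<longlonglongrightarrow> y + 0 *\<^sub>R w"
          by (intro tendsto_intros) real_asymp
        have "(\<lambda>n. f (y + ?s n *\<^sub>R w)) \<longlonglongrightarrow> f y"
          using isCont_tendsto_compose[OF \<open>isCont f y\<close>] lim by simp
        moreover have "\<forall>\<^sub>F n in sequentially. f (y + ?s n *\<^sub>R w) = ?n (y + ?s n *\<^sub>R w)"
        proof -
          have "\<forall>\<^sub>F n in sequentially. y + ?s n *\<^sub>R w \<in> ball y \<delta>"
            using lim \<delta>(1) by (intro topological_tendstoD[where l=y]) auto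
          then show ?thesis by eventually_elim simp
        qed
        ultimately have "(\<lambda>n. ?n (y + ?s n *\<^sub>R w)) \<longlonglongrightarrow> f y"
          by (rule Lim_transform_eventually)
        then show "(\<lambda>n. ?n (y + ?s n *\<^sub>R w) * gauss 1 w) \<longlonglongrightarrow> f y * gauss 1 w"
          by (intro tendsto_intros)
      qed
    qed measurable
    ultimately show ?thesis
      by (simp add: integral_gauss)
  qed
  have lim_b: "(\<lambda>n. \<integral>x. ?b x * gauss (?s n) (x - y) \<partial>lborel) \<longlonglongrightarrow> 0"
  proof (rule tendsto_0_le[where K=1])
    show "?C \<longlonglongrightarrow> 0" by (rule gauss_far[OF \<delta>(1)])
    have "norm (\<integral>x. ?b x * gauss (?s n) (x - y) \<partial>lborel) \<le> (\<integral>x. ?C n * f x \<partial>lborel)" for n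
      using integrable_f int_b bound_b[of _ n]
      by (intro Bochner_Integration.integral_norm_bound_integral) auto
    then show "\<forall>\<^sub>F n in sequentially. norm (\<integral>x. ?b x * gauss (?s n) (x - y) \<partial>lborel) \<le> norm (?C n) * 1"
      by (intro always_eventually allI) (auto simp: integral_f intro: order_trans)
  qed
  have "(\<integral>x. f x * gauss (?s n) (x - y) \<partial>lborel)
    = (\<integral>x. ?n x * gauss (?s n) (x - y) \<partial>lborel) + (\<integral>x. ?b x * gauss (?s n) (x - y) \<partial>lborel)" for n
    by (subst Bochner_Integration.integral_add[OF int_n int_b, symmetric])
      (intro Bochner_Integration.integral_cong refl, auto simp: indicator_def)
  then show ?thesis
    using tendsto_add[OF lim_n lim_b] by simp
qed

text \<open>
  The mollifications of \<open>f\<close> at \<open>0\<close> converge to \<open>f 0\<close> and are the integrals of \<open>g * gauss_weight \<sigma>\<close>, which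
  increases to a multiple of \<open>g\<close>. Fatou's lemma bounds the integral of \<open>g\<close> by \<open>(2 \<pi>)\<^sup>d f 0\<close>.
\<close>

lemma integrable_g: "integrable lborel g"
proof (rule integrableI_nonneg)
  let ?s = "\<lambda>n. 1 / real (Suc n)"
  let ?w = "\<lambda>n z. g z * gauss_weight (?s n) (z::'a)"
  let ?c = "(1 / (2 * pi)) ^ DIM('a)"
  have int: "integrable lborel (?w n)" for n
  proof (rule Bochner_Integration.integrable_bound)
    show "integrable lborel (gauss_weight (?s n) :: 'a \<Rightarrow> real)"
      by (rule integrable_gauss_weight) simp
    show "AE z in lborel. norm (?w n z) \<le> norm (gauss_weight (?s n) z)"
      using g_le_1 g_nonneg by (auto simp: abs_mult gauss_weight_nonneg intro!: mult_left_le_one_le)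
  qed measurable
  have lim: "(\<lambda>n. \<integral>z. ?w n z \<partial>lborel) \<longlonglongrightarrow> f 0"
  proof -
    have "(\<integral>x. f x * gauss (?s n) (x - 0) \<partial>lborel) = (\<integral>z. ?w n z \<partial>lborel)" for n
    proof -
      have "complex_of_real (\<integral>x. f x * gauss (?s n) (x - 0) \<partial>lborel) = complex_of_real (\<integral>z. ?w n z \<partial>lborel)"
        by (subst smoothed_inversion) (simp_all flip: integral_complex_of_real)
      then show ?thesis by (simp only: of_real_eq_iff)
    qed
    then show ?thesis using mollification_tendsto[of 0] by simp
  qed
  have "(\<integral>\<^sup>+z. ennreal (?c * g z) \<partial>lborel) = (\<integral>\<^sup>+z. liminf (\<lambda>n. ennreal (?w n z)) \<partial>lborel)"
  proof (intro nn_integral_cong lim_imp_Liminf[symmetric] tendsto_ennrealI)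
    fix z :: 'a
    have "(\<lambda>n. gauss_weight (?s n) z) \<longlonglongrightarrow> ?c * exp (- (0 * norm z)\<^sup>2 / 2)"
      unfolding gauss_weight_def by (intro tendsto_intros) (auto, real_asymp)
    then have "(\<lambda>n. ?w n z) \<longlonglongrightarrow> g z * ?c"
      by (intro tendsto_intros) simp
    then show "(\<lambda>n. ?w n z) \<longlonglongrightarrow> ?c * g z"
      by (simp add: mult.commute)
  qed simp
  also have "\<dots> \<le> liminf (\<lambda>n. \<integral>\<^sup>+z. ennreal (?w n z) \<partial>lborel)"
    by (intro nn_integral_liminf) auto
  also have "\<dots> = liminf (\<lambda>n. ennreal (\<integral>z. ?w n z \<partial>lborel))"
    using int g_nonneg by (subst nn_integral_eq_integral) (auto simp: gauss_weight_nonneg)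
  also have "\<dots> = ennreal (f 0)"
    using lim by (intro lim_imp_Liminf tendsto_ennrealI) auto
  finally have "(\<integral>\<^sup>+z. ennreal (?c * g z) \<partial>lborel) < \<infinity>"
    by (rule order_le_less_trans) simp
  then have "ennreal ?c * (\<integral>\<^sup>+z. ennreal (g z) \<partial>lborel) < \<infinity>"
    using g_nonneg by (subst nn_integral_cmult[symmetric]) (auto simp: ennreal_mult)
  then show "(\<integral>\<^sup>+z. ennreal (g z) \<partial>lborel) < \<infinity>"
    by (auto simp: ennreal_mult_less_top)
qed (use g_nonneg in auto)

text \<open>
  Both sides are the limit of the mollifications of \<open>f\<close> at \<open>y\<close> as \<open>\<sigma> \<longlonglongrightarrow> 0\<close>.
\<close>

theorem fourier_inversion:
  "complex_of_real (f y) = (\<integral>z. iexp (- (y \<bullet> z)) * complex_of_real ((1 / (2 * pi)) ^ DIM('a) * g z) \<partial>lborel)"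
proof (rule LIMSEQ_unique)
  let ?s = "\<lambda>n. 1 / real (Suc n)"
  let ?c = "(1 / (2 * pi)) ^ DIM('a)"
  show "(\<lambda>n. complex_of_real (\<integral>x. f x * gauss (?s n) (x - y) \<partial>lborel)) \<longlonglongrightarrow> complex_of_real (f y)"
    by (intro tendsto_of_real mollification_tendsto)
  have "(\<lambda>n. \<integral>z. iexp (- (y \<bullet> z)) * complex_of_real (g z * gauss_weight (?s n) z) \<partial>lborel)
    \<longlonglongrightarrow> (\<integral>z. iexp (- (y \<bullet> z)) * complex_of_real (?c * g z) \<partial>lborel)"
  proof (rule integral_dominated_convergence)
    show "integrable lborel (\<lambda>z. ?c * g z)" using integrable_g by simp
    show "AE z in lborel. norm (iexp (- (y \<bullet> z)) * complex_of_real (g z * gauss_weight (?s n) z)) \<le> ?c * g z" for n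
    proof (rule AE_I2)
      fix z :: 'a
      have "gauss_weight (?s n) z \<le> ?c * 1"
        unfolding gauss_weight_def by (intro mult_left_mono) auto
      then have "g z * gauss_weight (?s n) z \<le> g z * (?c * 1)"
        using g_nonneg[of z] by (rule mult_left_mono)
      then show "norm (iexp (- (y \<bullet> z)) * complex_of_real (g z * gauss_weight (?s n) z)) \<le> ?c * g z"
        using g_nonneg[of z] by (simp add: norm_mult gauss_weight_nonneg mult.commute)
    qed
    show "AE z in lborel. (\<lambda>n. iexp (- (y \<bullet> z)) * complex_of_real (g z * gauss_weight (?s n) z))
      \<longlonglongrightarrow> iexp (- (y \<bullet> z)) * complex_of_real (?c * g z)"
    proof (rule AE_I2)
      fix z :: 'a
      have "(\<lambda>n. gauss_weight (?s n) z) \<longlonglongrightarrow> ?c * exp (- (0 * norm z)\<^sup>2 / 2)"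
        unfolding gauss_weight_def by (intro tendsto_intros) (auto, real_asymp)
      then have "(\<lambda>n. g z * gauss_weight (?s n) z) \<longlonglongrightarrow> ?c * g z"
        using tendsto_mult[OF _ tendsto_const[of "g z"]] by (fastforce simp add: mult.commute)
      then show "(\<lambda>n. iexp (- (y \<bullet> z)) * complex_of_real (g z * gauss_weight (?s n) z))
          \<longlonglongrightarrow> iexp (- (y \<bullet> z)) * complex_of_real (?c * g z)"
        by (rule tendsto_mult[OF tendsto_const tendsto_of_real])
    qed
  qed measurable
  then show "(\<lambda>n. complex_of_real (\<integral>x. f x * gauss (?s n) (x - y) \<partial>lborel))
    \<longlonglongrightarrow> (\<integral>z. iexp (- (y \<bullet> z)) * complex_of_real (?c * g z) \<partial>lborel)"
    by (subst smoothed_inversion) auto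
qed

text \<open>
  Complex conjugation changes the sign in the exponent, because \<open>f\<close> and \<open>g\<close> are real.
\<close>

corollary fourier_inversion':
  "complex_of_real (f y) = (\<integral>z. iexp (y \<bullet> z) * complex_of_real ((1 / (2 * pi)) ^ DIM('a) * g z) \<partial>lborel)"
proof -
  have "complex_of_real (f y) = cnj (complex_of_real (f y))" by simp
  also have "\<dots> = (\<integral>z. iexp (y \<bullet> z) * complex_of_real ((1 / (2 * pi)) ^ DIM('a) * g z) \<partial>lborel)"
    unfolding fourier_inversion Bochner_Integration.integral_cnj[symmetric]
    by (intro Bochner_Integration.integral_cong refl) (simp add: exp_cnj)
  finally show ?thesis .
qed

lemma density_at_0: "f 0 = (1 / (2 * pi)) ^ DIM('a) * (\<integral>z. g z \<partial>lborel)"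
proof -
  have "complex_of_real (f 0) = complex_of_real ((1 / (2 * pi)) ^ DIM('a) * (\<integral>z. g z \<partial>lborel))"
    unfolding fourier_inversion
    by (simp del: of_real_mult of_real_power of_real_divide add: integral_complex_of_real)
  then show ?thesis by (simp only: of_real_eq_iff)
qed

lemma density_bounded: "f y \<le> f 0"
proof -
  have "norm (complex_of_real (f y)) \<le> (\<integral>z. norm (iexp (- (y \<bullet> z)) * complex_of_real ((1 / (2 * pi)) ^ DIM('a) * g z)) \<partial>lborel)"
    unfolding fourier_inversion by (rule integral_norm_bound)
  also have "\<dots> = f 0"
    unfolding density_at_0 norm_mult norm_exp_i_times norm_of_real using g_nonneg by (simp add: abs_mult)
  finally show ?thesis by simp
qed

end

section \<open>The symmetric stable density and the kernel of the process\<close>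

locale stable_density =
  fixes \<alpha> :: real and p :: "real \<Rightarrow> 'a::euclidean_space \<Rightarrow> real"
  assumes density: "stable_transition_density \<alpha> p"
    and alpha_pos: "0 < \<alpha>"
begin

lemma positive_fourier_density_p:
  assumes "0 < t"
  shows "positive_fourier_density (p t) (\<lambda>z. exp (- t * norm z powr \<alpha>))"
proof -
  have *: "continuous_on UNIV (p t) \<and> (\<forall>x. 0 \<le> p t x) \<and>
       prob_space (density lborel (\<lambda>x. ennreal (p t x))) \<and>
       (\<forall>z. (CLINT x|density lborel (\<lambda>x. ennreal (p t x)). iexp (z \<bullet> x))
              = complex_of_real (exp (- t * norm z powr \<alpha>)))"
    using density assms unfolding stable_transition_density_def by blast
  show ?thesis
  proof (rule positive_fourier_density.intro)
    show "(\<lambda>z::'a. exp (- t * norm z powr \<alpha>)) \<in> borel_measurable borel" by measurable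
    show "(CLINT x|density lborel (\<lambda>x. ennreal (p t x)). iexp (z \<bullet> x))
              = complex_of_real (exp (- t * norm z powr \<alpha>))" for z
      using * by blast
  qed (use * in \<open>simp_all\<close>)
qed

lemma p_nonneg: "0 < t \<Longrightarrow> 0 \<le> p t x"
  using density unfolding stable_transition_density_def by auto

text \<open>
  Self-similarity, seen through Fourier inversion at \<open>0\<close>: substitute \<open>z = t powr (- 1 / \<alpha>) w\<close>.
\<close>

lemma p_at_0:
  assumes "0 < t"
  shows "p t 0 = p 1 0 * t powr - (real DIM('a) / \<alpha>)"
proof -
  let ?c = "t powr - (1 / \<alpha>)"
  let ?G = "\<lambda>t z::'a. exp (- t * norm z powr \<alpha>)"
  have c: "0 < ?c" using assms by simp
  have "(\<integral>z. ?G t z \<partial>lborel) = (\<integral>z. ?G t z \<partial>density (distr lborel borel (\<lambda>w. 0 + ?c *\<^sub>R w)) (\<lambda>_. \<bar>?c\<bar>^DIM('a)))"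
    using c by (subst lborel_affine[of ?c 0]) auto
  also have "\<dots> = (\<integral>w. ?c ^ DIM('a) * ?G t (?c *\<^sub>R w) \<partial>lborel)"
    using c by (subst integral_density) (auto simp: integral_distr)
  also have "\<dots> = (\<integral>w. ?c ^ DIM('a) * ?G 1 w \<partial>lborel)"
  proof (intro Bochner_Integration.integral_cong refl)
    fix w :: 'a
    have "t * ?c powr \<alpha> = 1"
      using assms alpha_pos by (simp add: powr_powr powr_neg_one)
    then have "t * norm (?c *\<^sub>R w) powr \<alpha> = norm w powr \<alpha>"
      by (simp add: powr_mult flip: mult.assoc)
    then show "?c ^ DIM('a) * ?G t (?c *\<^sub>R w) = ?c ^ DIM('a) * ?G 1 w" by simp
  qed
  also have "?c ^ DIM('a) = t powr - (real DIM('a) / \<alpha>)"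
    unfolding powr_realpow[OF c, symmetric] by (simp add: powr_powr)
  finally have "(\<integral>z. ?G t z \<partial>lborel) = t powr - (real DIM('a) / \<alpha>) * (\<integral>z. ?G 1 z \<partial>lborel)"
    by simp
  then show ?thesis
    unfolding positive_fourier_density.density_at_0[OF positive_fourier_density_p[OF assms]]
      positive_fourier_density.density_at_0[OF positive_fourier_density_p[OF zero_less_one]]
    by (simp only: mult.assoc mult.left_commute mult.commute)
qed

text \<open>
  The Chapman-Kolmogorov equation at \<open>0\<close>, using that \<open>p b\<close> is even. In Fourier terms, the
  characteristic functions at times \<open>a\<close> and \<open>b\<close> multiply to that at time \<open>a + b\<close>.
\<close>

lemma chapman_kolmogorov_at_0:
  assumes "0 < a" "0 < b"
  shows "(\<integral>\<^sup>+x. ennreal (p a x) * ennreal (p b x) \<partial>lborel) = ennreal (p (a + b) 0)"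
proof -
  interpret A: positive_fourier_density "p a" "\<lambda>z. exp (- a * norm z powr \<alpha>)"
    by (rule positive_fourier_density_p) fact
  interpret B: positive_fourier_density "p b" "\<lambda>z. exp (- b * norm z powr \<alpha>)"
    by (rule positive_fourier_density_p) fact
  interpret AB: positive_fourier_density "p (a + b)" "\<lambda>z. exp (- (a + b) * norm z powr \<alpha>)"
    by (rule positive_fourier_density_p) (use assms in simp)
  let ?c = "(1 / (2 * pi)) ^ DIM('a)"
  let ?h = "\<lambda>z::'a. ?c * exp (- b * norm z powr \<alpha>)"
  have h: "integrable lborel ?h"
    by (rule integrable_mult_right[OF B.integrable_g])
  have "complex_of_real (\<integral>x. p a x * p b x \<partial>lborel) = (CLINT x|A.D. complex_of_real (p b x))"
    by (subst A.integral_D) (auto simp: scaleR_conv_of_real simp flip: integral_complex_of_real)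
  also have "\<dots> = (CLINT x|A.D. (\<integral>z. iexp ((x - 0) \<bullet> z) * complex_of_real (?h z) \<partial>lborel))"
    unfolding B.fourier_inversion' by simp
  also have "\<dots> = (\<integral>z. iexp (- ((0::'a) \<bullet> z)) * complex_of_real (exp (- a * norm z powr \<alpha>) * ?h z) \<partial>lborel)"
    by (rule A.parseval[OF h])
  also have "\<dots> = (\<integral>z. complex_of_real (?c * exp (- (a + b) * norm (z::'a) powr \<alpha>)) \<partial>lborel)"
  proof (intro Bochner_Integration.integral_cong refl)
    fix z :: 'a
    have "exp (- a * norm z powr \<alpha>) * ?h z = ?c * exp (- (a + b) * norm z powr \<alpha>)"
      by (simp add: mult.left_commute left_diff_distrib flip: exp_add)
    then show "iexp (- ((0::'a) \<bullet> z)) * complex_of_real (exp (- a * norm z powr \<alpha>) * ?h z)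
      = complex_of_real (?c * exp (- (a + b) * norm z powr \<alpha>))"
      by (simp only:) simp
  qed
  also have "\<dots> = complex_of_real (p (a + b) 0)"
    unfolding integral_complex_of_real AB.density_at_0 by simp
  finally have eq: "(\<integral>x. p a x * p b x \<partial>lborel) = p (a + b) 0"
    by (simp only: of_real_eq_iff)
  have "integrable lborel (\<lambda>x. p a x * p b x)"
  proof (rule Bochner_Integration.integrable_bound)
    show "integrable lborel (\<lambda>x. p a x * p b 0)"
      using A.integrable_f by simp
    show "AE x in lborel. norm (p a x * p b x) \<le> norm (p a x * p b 0)"
      using A.f_nonneg B.f_nonneg B.density_bounded by (auto simp: abs_mult intro!: mult_left_mono)
  qed measurable
  then have "(\<integral>\<^sup>+x. ennreal (p a x * p b x) \<partial>lborel) = ennreal (p (a + b) 0)"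
    using A.f_nonneg B.f_nonneg by (subst nn_integral_eq_integral) (auto simp: eq)
  then show ?thesis
    using A.f_nonneg B.f_nonneg by (simp add: ennreal_mult)
qed

text \<open>
  The family \<open>p\<close> is arbitrary at times \<open>t \<le> 0\<close>; cutting these off makes it jointly measurable.
\<close>

definition positive_time_density :: "real \<times> 'a \<Rightarrow> ennreal"
  where "positive_time_density = (\<lambda>(t, x). ennreal (p t x) * indicator {0<..} t)"

text \<open>
  Fourier inversion writes the density as a parameter integral of a jointly measurable function.
\<close>

lemma borel_measurable_positive_time_density [measurable]: "positive_time_density \<in> borel_measurable (borel \<Otimes>\<^sub>M borel)"
proof -
  let ?h = "\<lambda>(t, x::'a). (\<integral>z. iexp (- (x \<bullet> z)) * complex_of_real ((1 / (2 * pi)) ^ DIM('a) * exp (- t * norm z powr \<alpha>)) \<partial>lborel)"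
  have "?h \<in> borel_measurable (borel \<Otimes>\<^sub>M borel)"
    unfolding split_beta' by (intro lborel.borel_measurable_lebesgue_integral) measurable
  then have H: "(\<lambda>y. Re (?h y)) \<in> borel_measurable (borel \<Otimes>\<^sub>M borel)"
    by (rule measurable_compose[OF _ borel_measurable_Re])
  define H where "H = (\<lambda>y. Re (?h y))"
  have [measurable]: "H \<in> borel_measurable (borel \<Otimes>\<^sub>M borel)"
    using H unfolding H_def .
  have "positive_time_density = (\<lambda>y. ennreal (H y) * indicator {0<..} (fst y))"
  proof
    fix y :: "real \<times> 'a"
    obtain t x where y: "y = (t, x)" by (cases y)
    show "positive_time_density y = ennreal (H y) * indicator {0<..} (fst y)"
    proof (cases "0 < t")
      case True
      have "H y = p t x"
        unfolding H_def y prod.case positive_fourier_density.fourier_inversion[OF positive_fourier_density_p[OF True], of x, symmetric]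
        by simp
      then show ?thesis using True by (simp add: y positive_time_density_def)
    qed (simp add: y positive_time_density_def)
  qed
  also have "\<dots> \<in> borel_measurable (borel \<Otimes>\<^sub>M borel)" by measurable
  finally show ?thesis .
qed

text \<open>
  The time integral of the density with values in \<open>[0, \<infinity>]\<close>, on which Tonelli's theorem is available; it may
  be infinite at \<open>x = 0\<close>.
\<close>

definition occupation :: "real \<Rightarrow> 'a \<Rightarrow> ennreal"
  where "occupation T x = (\<integral>\<^sup>+u. positive_time_density (u, x) * indicator {0<..<T} u \<partial>lborel)"

lemma borel_measurable_occupation [measurable]:
  "(\<lambda>(r, x). occupation (t - r) x) \<in> borel_measurable (borel \<Otimes>\<^sub>M borel)"
proof -
  have "(\<lambda>(r, x). occupation (t - r) x) = (\<lambda>y. \<integral>\<^sup>+u. (if 0 < u \<and> u < t - fst y then positive_time_density (u, snd y) else 0) \<partial>lborel)"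
    by (auto simp: occupation_def fun_eq_iff indicator_def intro!: nn_integral_cong)
  also have "\<dots> \<in> borel_measurable (borel \<Otimes>\<^sub>M borel)"
    by (intro lborel.borel_measurable_nn_integral) measurable
  finally show ?thesis .
qed

lemma borel_measurable_occupation' [measurable]: "occupation T \<in> borel_measurable borel"
  using measurable_Pair2[OF borel_measurable_occupation[of T], of 0] by simp

text \<open>
  Its total mass over space is \<open>T\<close>.
\<close>

lemma AE_occupation_finite:
  assumes "0 \<le> T"
  shows "AE x in lborel. occupation T x < \<infinity>"
proof -
  have "(\<integral>\<^sup>+x. occupation T x \<partial>lborel) = (\<integral>\<^sup>+u. (\<integral>\<^sup>+x. positive_time_density (u, x) * indicator {0<..<T} u \<partial>lborel) \<partial>lborel)"
    unfolding occupation_def by (rule lborel_pair.Fubini') measurable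
  also have "\<dots> = (\<integral>\<^sup>+u. indicator {0<..<T} u \<partial>lborel)"
  proof (intro nn_integral_cong)
    fix u :: real
    show "(\<integral>\<^sup>+x. positive_time_density (u, x) * indicator {0<..<T} u \<partial>lborel) = indicator {0<..<T} u"
    proof (cases "0 < u \<and> u < T")
      case True
      interpret U: positive_fourier_density "p u" "\<lambda>z. exp (- u * norm z powr \<alpha>)"
        by (rule positive_fourier_density_p) (use True in simp)
      interpret prob_space U.D by (rule U.prob)
      have "(\<integral>\<^sup>+x. ennreal (p u x) \<partial>lborel) = 1"
        using emeasure_space_1 by (simp add: emeasure_density)
      then show ?thesis using True by (simp add: positive_time_density_def)
    qed auto
  qed
  also have "\<dots> < \<infinity>" using assms by (subst nn_integral_indicator) auto
  finally have "(\<integral>\<^sup>+x. occupation T x \<partial>lborel) \<noteq> \<infinity>" by simp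
  then have "AE x in lborel. occupation T x \<noteq> \<infinity>"
    by (intro nn_integral_PInf_AE) simp_all
  then show ?thesis by (simp add: less_top)
qed

text \<open>
  By Tonelli's theorem and the Chapman-Kolmogorov equation at \<open>0\<close>, the left-hand side is \<open>p 1 0\<close> times
  the integral of \<open>(a + b) powr - (d / \<alpha>)\<close> over the rectangle with sides \<open>S\<close> and \<open>T\<close>.
\<close>

lemma occupation_inner:
  assumes prim: "iterated_primitives (\<lambda>x. x powr - (real DIM('a) / \<alpha>)) \<phi>1 \<phi>2 \<phi>3"
    and "0 \<le> S" "0 \<le> T"
  shows "(\<integral>\<^sup>+x. occupation S x * occupation T x \<partial>lborel) = ennreal (p 1 0 * (\<phi>2 (S + T) - \<phi>2 S - \<phi>2 T))"
proof -
  interpret iterated_primitives "\<lambda>x. x powr - (real DIM('a) / \<alpha>)" \<phi>1 \<phi>2 \<phi>3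
    by (rule prim)
  let ?\<phi> = "\<lambda>x. x powr - (real DIM('a) / \<alpha>)"
  let ?k = "\<lambda>T u x. positive_time_density (u, x) * indicator {0<..<T} u"
  have p0: "0 \<le> p 1 0" by (rule p_nonneg) simp
  define K where "K T y = positive_time_density y * indicator {0<..<T} (fst y)" for T and y :: "real \<times> 'a"
  have [measurable]: "K T \<in> borel_measurable (borel \<Otimes>\<^sub>M borel)" for T
    unfolding K_def by measurable
  have occ: "occupation T x = (\<integral>\<^sup>+u. K T (u, x) \<partial>lborel)" for T x
    by (simp add: occupation_def K_def)
  have "(\<integral>\<^sup>+x. occupation S x * occupation T x \<partial>lborel)
    = (\<integral>\<^sup>+x. (\<integral>\<^sup>+a. K S (a, x) * occupation T x \<partial>lborel) \<partial>lborel)"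
    unfolding occ[of S] by (subst nn_integral_multc) auto
  also have "\<dots> = (\<integral>\<^sup>+a. (\<integral>\<^sup>+x. K S (a, x) * occupation T x \<partial>lborel) \<partial>lborel)"
    by (rule lborel_pair.Fubini') measurable
  also have "\<dots> = (\<integral>\<^sup>+a. (\<integral>\<^sup>+x. (\<integral>\<^sup>+b. K S (a, x) * K T (b, x) \<partial>lborel) \<partial>lborel) \<partial>lborel)"
    unfolding occ by (subst nn_integral_cmult) auto
  also have "\<dots> = (\<integral>\<^sup>+a. (\<integral>\<^sup>+b. (\<integral>\<^sup>+x. K S (a, x) * K T (b, x) \<partial>lborel) \<partial>lborel) \<partial>lborel)"
  proof (rule nn_integral_cong)
    fix a :: real
    show "(\<integral>\<^sup>+x. (\<integral>\<^sup>+b. K S (a, x) * K T (b, x) \<partial>lborel) \<partial>lborel)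
      = (\<integral>\<^sup>+b. (\<integral>\<^sup>+x. K S (a, x) * K T (b, x) \<partial>lborel) \<partial>lborel)"
      by (rule lborel_pair.Fubini') measurable
  qed
  also have "\<dots> = (\<integral>\<^sup>+a. (\<integral>\<^sup>+b. ennreal (p 1 0) * ((ennreal (?\<phi> (a + b)) * indicator {0<..<T} b) * indicator {0<..<S} a) \<partial>lborel) \<partial>lborel)"
  proof (rule nn_integral_cong, rule nn_integral_cong)
    fix a b :: real
    show "(\<integral>\<^sup>+x. K S (a, x) * K T (b, x) \<partial>lborel) = ennreal (p 1 0) * ((ennreal (?\<phi> (a + b)) * indicator {0<..<T} b) * indicator {0<..<S} a)"
    proof (cases "a \<in> {0<..<S} \<and> b \<in> {0<..<T}")
      case True
      then have "(\<integral>\<^sup>+x. K S (a, x) * K T (b, x) \<partial>lborel) = ennreal (p (a + b) 0)"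
        using chapman_kolmogorov_at_0[of a b] by (simp add: K_def positive_time_density_def)
      also have "\<dots> = ennreal (p 1 0) * ennreal (?\<phi> (a + b))"
        using True p0 by (subst p_at_0) (auto simp: ennreal_mult)
      finally show ?thesis using True by simp
    next
      case False
      then have "(\<lambda>x. K S (a, x) * K T (b, x)) = (\<lambda>x. 0)" by (auto simp: K_def)
      then show ?thesis using False by (simp only: nn_integral_const) (auto simp: indicator_def)
    qed
  qed
  also have "\<dots> = ennreal (p 1 0) * (\<integral>\<^sup>+a. (\<integral>\<^sup>+b. (ennreal (?\<phi> (a + b)) * indicator {0<..<T} b) * indicator {0<..<S} a \<partial>lborel) \<partial>lborel)"
    by (subst nn_integral_cmult, measurable)+
  also have "\<dots> = ennreal (p 1 0) * (\<integral>\<^sup>+a. (\<integral>\<^sup>+b. ennreal (?\<phi> (a + b)) * indicator {0<..<T} b \<partial>lborel) * indicator {0<..<S} a \<partial>lborel)"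
    by (subst nn_integral_multc) auto
  also have "\<dots> = ennreal (p 1 0 * (\<phi>2 (S + T) - \<phi>2 S - \<phi>2 T))"
    unfolding double_integral(1)[OF assms(2,3)] by (rule ennreal_mult[symmetric, OF p0 double_integral(2)[OF assms(2,3)]])
  finally show ?thesis .
qed

text \<open>
  The Bochner integral in \<open>xi_kernel\<close> and \<open>enn2real\<close> both return \<open>0\<close> when the occupation is infinite, so
  the identity holds at every point.
\<close>

lemma xi_kernel_eq: "xi_kernel p t (r, x) = indicator {0..t} r * enn2real (occupation (t - r) x)"
proof (cases "r \<in> {0..t}")
  case True
  then have rt: "ereal r \<le> ereal t" by simp
  have m: "(\<lambda>u. positive_time_density (u - r, x)) \<in> borel_measurable borel" by measurable
  have k: "(\<lambda>u. indicator {r<..<t} u *\<^sub>R p (u - r) x) = (\<lambda>u. enn2real (positive_time_density (u - r, x) * indicator {r<..<t} u))"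
    by (auto simp: fun_eq_iff indicator_def positive_time_density_def p_nonneg)
  have "(LBINT u=r..t. p (u - r) x) = (\<integral>u. indicator {r<..<t} u *\<^sub>R p (u - r) x \<partial>lborel)"
    using rt by (simp add: interval_lebesgue_integral_def set_lebesgue_integral_def)
  also have "\<dots> = enn2real (\<integral>\<^sup>+u. ennreal (indicator {r<..<t} u *\<^sub>R p (u - r) x) \<partial>lborel)"
  proof (rule integral_eq_nn_integral)
    show "(\<lambda>u. indicator {r<..<t} u *\<^sub>R p (u - r) x) \<in> borel_measurable lborel"
      unfolding k using m by measurable
    show "AE u in lborel. 0 \<le> indicator {r<..<t} u *\<^sub>R p (u - r) x"
      by (auto simp: indicator_def p_nonneg)
  qed
  also have "(\<integral>\<^sup>+u. ennreal (indicator {r<..<t} u *\<^sub>R p (u - r) x) \<partial>lborel) = (\<integral>\<^sup>+u. positive_time_density (u - r, x) * indicator {r<..<t} u \<partial>lborel)"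
    by (intro nn_integral_cong) (auto simp: indicator_def positive_time_density_def)
  also have "\<dots> = (\<integral>\<^sup>+u. positive_time_density (u, x) * indicator {0<..<t - r} u \<partial>lborel)"
    by (subst nn_integral_real_affine[of _ 1 r]) (auto simp: indicator_def intro!: nn_integral_cong)
  finally show ?thesis using True by (simp add: xi_kernel_def occupation_def)
qed (simp add: xi_kernel_def)

lemma xi_kernel_nonneg: "0 \<le> xi_kernel p t y"
  by (cases y) (simp add: xi_kernel_eq)

lemma borel_measurable_xi_kernel [measurable]: "xi_kernel p t \<in> borel_measurable borel"
proof -
  have "xi_kernel p t = (\<lambda>y. indicator {0..t} (fst y) * enn2real ((\<lambda>(r, x). occupation (t - r) x) y))"
    by (auto simp: xi_kernel_eq fun_eq_iff)
  also have "\<dots> \<in> borel_measurable (borel \<Otimes>\<^sub>M borel)" by measurable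
  finally show ?thesis by (simp add: borel_prod)
qed

text \<open>
  Integrate the inner products over space for a fixed starting time \<open>r\<close>, then over \<open>r\<close> from \<open>0\<close> to the
  minimum of \<open>s\<close> and \<open>t\<close>. In particular the kernels are square integrable.
\<close>

lemma xi_kernel_inner:
  assumes prim: "iterated_primitives (\<lambda>x. x powr - (real DIM('a) / \<alpha>)) \<phi>1 \<phi>2 \<phi>3"
    and st: "0 \<le> s" "0 \<le> t"
  shows "has_bochner_integral lborel (\<lambda>y. xi_kernel p s y * xi_kernel p t y)
    (p 1 0 * (1 / 2 * (\<phi>3 (s + t) + \<phi>3 \<bar>s - t\<bar>) - \<phi>3 s - \<phi>3 t))"
proof (rule has_bochner_integral_nn_integral)
  interpret iterated_primitives "\<lambda>x. x powr - (real DIM('a) / \<alpha>)" \<phi>1 \<phi>2 \<phi>3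
    by (rule prim)
  have p0: "0 \<le> p 1 0" by (rule p_nonneg) simp
  let ?V = "1 / 2 * (\<phi>3 (s + t) + \<phi>3 \<bar>s - t\<bar>) - \<phi>3 s - \<phi>3 t"
  have V: "0 \<le> ?V" by (rule triple_integral[OF st])
  then show "0 \<le> p 1 0 * ?V" using p0 by simp
  have "(\<integral>\<^sup>+y. ennreal (xi_kernel p s y * xi_kernel p t y) \<partial>lborel)
    = (\<integral>\<^sup>+r. \<integral>\<^sup>+x. ennreal (xi_kernel p s (r, x) * xi_kernel p t (r, x)) \<partial>lborel \<partial>lborel)"
    by (subst lborel_prod[symmetric], subst lborel.nn_integral_fst[symmetric]) (simp_all add: lborel_prod)
  also have "\<dots> = (\<integral>\<^sup>+r. ennreal (p 1 0) * (ennreal (\<phi>2 (s + t - 2 * r) - \<phi>2 (s - r) - \<phi>2 (t - r)) * indicator {0<..<min s t} r) \<partial>lborel)"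
  proof (rule nn_integral_cong_AE)
    have "AE r in lborel. r \<noteq> 0 \<and> r \<noteq> min s t"
      by (intro AE_conjI AE_lborel_singleton)
    then show "AE r in lborel. (\<integral>\<^sup>+x. ennreal (xi_kernel p s (r, x) * xi_kernel p t (r, x)) \<partial>lborel)
      = ennreal (p 1 0) * (ennreal (\<phi>2 (s + t - 2 * r) - \<phi>2 (s - r) - \<phi>2 (t - r)) * indicator {0<..<min s t} r)"
    proof eventually_elim
      fix r assume r: "r \<noteq> 0 \<and> r \<noteq> min s t"
      show "(\<integral>\<^sup>+x. ennreal (xi_kernel p s (r, x) * xi_kernel p t (r, x)) \<partial>lborel)
      = ennreal (p 1 0) * (ennreal (\<phi>2 (s + t - 2 * r) - \<phi>2 (s - r) - \<phi>2 (t - r)) * indicator {0<..<min s t} r)"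
      proof (cases "r \<in> {0<..<min s t}")
        case True
        then have sr: "0 \<le> s - r" "0 \<le> t - r" by auto
        have "(\<integral>\<^sup>+x. ennreal (xi_kernel p s (r, x) * xi_kernel p t (r, x)) \<partial>lborel)
          = (\<integral>\<^sup>+x. occupation (s - r) x * occupation (t - r) x \<partial>lborel)"
          using AE_occupation_finite[OF sr(1)] AE_occupation_finite[OF sr(2)] True
          by (intro nn_integral_cong_AE) (auto simp: xi_kernel_eq ennreal_mult)
        also have "\<dots> = ennreal (p 1 0 * (\<phi>2 (s + t - 2 * r) - \<phi>2 (s - r) - \<phi>2 (t - r)))"
          using occupation_inner[OF prim sr] by (simp add: algebra_simps)
        finally show ?thesis
          using True p0 by (simp add: ennreal_mult')
      next
        case False
        then have "r \<notin> {0..s} \<or> r \<notin> {0..t}" using r by auto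
        then have "(\<lambda>x. ennreal (xi_kernel p s (r, x) * xi_kernel p t (r, x))) = (\<lambda>x. 0)"
          by (auto simp: xi_kernel_eq)
        then show ?thesis using False by (simp only: nn_integral_const) (auto simp: indicator_def)
      qed
    qed
  qed
  also have "\<dots> = ennreal (p 1 0) * ennreal ?V"
  proof (subst nn_integral_cmult)
    let ?f = "\<lambda>r. \<phi>2 (s + t - 2 * r) - \<phi>2 (s - r) - \<phi>2 (t - r)"
    have "continuous_on {0<..<min s t} ?f"
      by (rule continuous_on_diff[OF continuous_on_diff[OF continuous_on_compose2[OF C2] continuous_on_compose2[OF C2]]
            continuous_on_compose2[OF C2]]) (auto intro!: continuous_intros)
    then have "(\<lambda>r. indicator {0<..<min s t} r *\<^sub>R ?f r) \<in> borel_measurable borel"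
      by (intro borel_measurable_continuous_on_indicator) auto
    then have "(\<lambda>r. ennreal (indicator {0<..<min s t} r *\<^sub>R ?f r)) \<in> borel_measurable borel"
      by (rule measurable_compose[OF _ measurable_ennreal])
    also have "(\<lambda>r. ennreal (indicator {0<..<min s t} r *\<^sub>R ?f r)) = (\<lambda>r. ennreal (?f r) * indicator {0<..<min s t} r)"
      by (auto simp: indicator_def fun_eq_iff)
    finally show "(\<lambda>r. ennreal (?f r) * indicator {0<..<min s t} r) \<in> borel_measurable lborel"
      by simp
  qed (simp only: triple_integral(1)[OF st])
  also have "\<dots> = ennreal (p 1 0 * ?V)"
    using p0 V by (simp add: ennreal_mult)
  finally show "(\<integral>\<^sup>+y. ennreal (xi_kernel p s y * xi_kernel p t y) \<partial>lborel) = ennreal (p 1 0 * ?V)" .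
qed (auto simp: xi_kernel_nonneg)

end

section \<open>Gaussian random measures and elementary integrals\<close>

lemma (in prob_space) char_distr_cong_AE:
  assumes "X \<in> borel_measurable M" "Y \<in> borel_measurable M" "AE \<omega> in M. X \<omega> = Y \<omega>"
  shows "char (distr M borel X) z = char (distr M borel Y) z"
proof -
  have "distr M borel X = distr M borel Y"
    using assms by (intro distr_cong_AE) auto
  then show ?thesis by simp
qed

lemma (in prob_space) char_distr_cmult:
  assumes [measurable]: "X \<in> borel_measurable M"
  shows "char (distr M borel (\<lambda>\<omega>. c * X \<omega>)) z = char (distr M borel X) (c * z)"
  by (simp add: char_def integral_distr ac_simps)

text \<open>
  For \<open>\<beta> = 1\<close> the skewness term disappears, since \<open>tan \<pi> = 0\<close>, and \<open>M A\<close> is centred normal with variance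
  twice the volume of \<open>A\<close>.
\<close>

locale gaussian_random_measure =
  fixes P :: "'w measure" and M :: "'e::euclidean_space set \<Rightarrow> 'w \<Rightarrow> real"
  assumes rm: "stable_random_measure 1 P M"
begin

sublocale prob_space P
  using rm by (simp add: stable_random_measure_def)

lemma M_borel: "A \<in> finite_borel_sets \<Longrightarrow> M A \<in> borel_measurable P"
  using rm by (simp add: stable_random_measure_def)

lemma char_M_pos:
  assumes "A \<in> finite_borel_sets" "0 < measure lborel A"
  shows "char (distr P borel (M A)) z = complex_of_real (exp (- (measure lborel A * z\<^sup>2)))"
proof -
  have "char (distr P borel (M A)) z =
          exp (- complex_of_real (measure lborel A * \<bar>z\<bar> powr (1 + 1)) *
               (1 - \<i> * complex_of_real (sgn z * tan (pi / 2 * (1 + 1)))))"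
    using rm assms unfolding stable_random_measure_def by blast
  also have "\<dots> = complex_of_real (exp (- (measure lborel A * z\<^sup>2)))"
    by (simp flip: exp_of_real)
  finally show ?thesis .
qed

lemma M_indep:
  fixes A :: "nat \<Rightarrow> 'e set"
  assumes "finite I" "A ` I \<subseteq> finite_borel_sets" "disjoint_family_on A I"
  shows "indep_vars (\<lambda>_. borel) (\<lambda>i. M (A i)) I"
  using rm assms unfolding stable_random_measure_def by blast

lemma M_sums:
  fixes A :: "nat \<Rightarrow> 'e set"
  assumes "range A \<subseteq> finite_borel_sets" "disjoint_family A" "(\<Union>i. A i) \<in> finite_borel_sets"
  shows "AE \<omega> in P. (\<lambda>i. M (A i) \<omega>) sums M (\<Union>i. A i) \<omega>"
  using rm assms unfolding stable_random_measure_def by blast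

lemma empty_finite_borel: "{} \<in> finite_borel_sets"
  by (simp add: finite_borel_sets_def)

lemma Un_finite_borel: "A \<in> finite_borel_sets \<Longrightarrow> B \<in> finite_borel_sets \<Longrightarrow> A \<union> B \<in> finite_borel_sets"
  using emeasure_subadditive[of A lborel B]
  by (auto simp: finite_borel_sets_def ennreal_add_less_top order_le_less_trans)

lemma UN_finite_borel: "finite I \<Longrightarrow> (\<And>i. i \<in> I \<Longrightarrow> A i \<in> finite_borel_sets) \<Longrightarrow> (\<Union>i\<in>I. A i) \<in> finite_borel_sets"
  by (induction I rule: finite_induct) (auto simp: empty_finite_borel Un_finite_borel)

text \<open>
  A convergent series with constant terms \<open>M {}\<close> has terms \<open>0\<close>.
\<close>

lemma AE_M_empty: "AE \<omega> in P. M {} \<omega> = 0"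
proof -
  have "AE \<omega> in P. (\<lambda>i. M ((\<lambda>_. {}) i) \<omega>) sums M (\<Union>i::nat. (\<lambda>_. {}) i) \<omega>"
    by (rule M_sums) (auto simp: empty_finite_borel disjoint_family_on_def)
  then show ?thesis
  proof eventually_elim
    fix \<omega> assume "(\<lambda>i. M ((\<lambda>_. {}) i) \<omega>) sums M (\<Union>i::nat. (\<lambda>_. {}) i) \<omega>"
    then have "(\<lambda>i::nat. M {} \<omega>) \<longlonglongrightarrow> 0" by (auto intro: summable_LIMSEQ_zero sums_summable)
    then show "M {} \<omega> = 0" by (simp add: LIMSEQ_const_iff)
  qed
qed

lemma AE_M_Un:
  assumes "A \<in> finite_borel_sets" "B \<in> finite_borel_sets" "A \<inter> B = {}"
  shows "AE \<omega> in P. M (A \<union> B) \<omega> = M A \<omega> + M B \<omega>"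
proof -
  have "AE \<omega> in P. (\<lambda>i. M (binaryset A B i) \<omega>) sums M (\<Union>i. binaryset A B i) \<omega>"
    using assms by (intro M_sums)
      (auto simp: range_binaryset_eq UN_binaryset_eq empty_finite_borel Un_finite_borel disjoint_family_on_def binaryset_def)
  with AE_M_empty show ?thesis
  proof eventually_elim
    fix \<omega> assume 0: "M {} \<omega> = 0" and s: "(\<lambda>i. M (binaryset A B i) \<omega>) sums M (\<Union>i. binaryset A B i) \<omega>"
    show "M (A \<union> B) \<omega> = M A \<omega> + M B \<omega>"
      using sums_unique2[OF s binaryset_sums[where f="\<lambda>A. M A \<omega>", OF 0]] by (simp add: UN_binaryset_eq)
  qed
qed

lemma AE_M_UN:
  assumes "finite I" "\<And>i. i \<in> I \<Longrightarrow> A i \<in> finite_borel_sets" "disjoint_family_on A I"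
  shows "AE \<omega> in P. M (\<Union>i\<in>I. A i) \<omega> = (\<Sum>i\<in>I. M (A i) \<omega>)"
  using assms
proof (induction I rule: finite_induct)
  case (insert i I)
  have "AE \<omega> in P. M (A i \<union> (\<Union>i\<in>I. A i)) \<omega> = M (A i) \<omega> + M (\<Union>i\<in>I. A i) \<omega>"
    using insert.prems insert.hyps
    by (intro AE_M_Un UN_finite_borel) (auto simp: disjoint_family_on_def)
  moreover have "AE \<omega> in P. M (\<Union>i\<in>I. A i) \<omega> = (\<Sum>i\<in>I. M (A i) \<omega>)"
    using insert by (intro insert.IH) (auto simp: disjoint_family_on_def)
  ultimately show ?case
    by eventually_elim (use insert.hyps in simp)
qed (simp add: AE_M_empty)

text \<open>
  The characteristic function of \<open>M A\<close> is prescribed only for sets of positive volume. A null set \<open>A\<close> is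
  added to a set \<open>B\<close> of volume \<open>1\<close>: since \<open>M A\<close> and \<open>M B\<close> are independent and \<open>M (A \<union> B)\<close> has the law of
  \<open>M B\<close>, the characteristic function of \<open>M A\<close> must be \<open>1\<close>.
\<close>

lemma char_M:
  assumes A: "A \<in> finite_borel_sets"
  shows "char (distr P borel (M A)) z = complex_of_real (exp (- (measure lborel A * z\<^sup>2)))"
proof (cases "0 < measure lborel A")
  case False
  then have A0: "measure lborel A = 0" by (simp add: zero_less_measure_iff)
  then have null: "A \<in> null_sets lborel"
    using A by (auto simp: finite_borel_sets_def measure_def enn2real_eq_0_iff null_sets_def)
  define B where "B = cbox 0 (\<Sum>b\<in>Basis. b) - A"
  have B: "B \<in> finite_borel_sets"
    using A emeasure_mono[of B "cbox 0 (\<Sum>b\<in>Basis. b)" lborel]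
    by (auto simp: finite_borel_sets_def B_def intro: order_le_less_trans emeasure_lborel_cbox_finite)
  have mB: "measure lborel B = 1"
    using null unfolding B_def by (simp add: measure_Diff_null_set)
  have AB: "A \<inter> B = {}" by (auto simp: B_def)
  have "char (distr P borel (\<lambda>\<omega>. \<Sum>i\<in>{0,1::nat}. M (if i = 0 then A else B) \<omega>)) z
    = (\<Prod>i\<in>{0,1::nat}. char (distr P borel (M (if i = 0 then A else B))) z)"
    using A B AB by (intro char_distr_sum M_indep) (auto simp: disjoint_family_on_def)
  then have "char (distr P borel (\<lambda>\<omega>. M A \<omega> + M B \<omega>)) z = char (distr P borel (M A)) z * char (distr P borel (M B)) z"
    by simp
  moreover have "char (distr P borel (\<lambda>\<omega>. M A \<omega> + M B \<omega>)) z = char (distr P borel (M (A \<union> B))) z"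
    using AE_M_Un[OF A B AB] A B Un_finite_borel[OF A B]
    by (intro char_distr_cong_AE borel_measurable_add M_borel) auto
  moreover have "measure lborel (A \<union> B) = 1"
    using null B mB by (subst Un_commute, subst measure_Un_null_set) (auto simp: finite_borel_sets_def)
  ultimately show ?thesis
    using char_M_pos[OF B] char_M_pos[OF Un_finite_borel[OF A B]] mB A0 by simp
qed (rule char_M_pos[OF A])

lemma char_sum_M:
  fixes A :: "'j \<Rightarrow> 'e set" and c :: "'j \<Rightarrow> real"
  assumes J: "finite J" and A: "\<And>j. j \<in> J \<Longrightarrow> A j \<in> finite_borel_sets" and disj: "disjoint_family_on A J"
  shows "char (distr P borel (\<lambda>\<omega>. \<Sum>j\<in>J. c j * M (A j) \<omega>)) z
    = complex_of_real (exp (- ((\<Sum>j\<in>J. (c j)\<^sup>2 * measure lborel (A j)) * z\<^sup>2)))"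
proof -
  \<comment> \<open>The independence hypothesis speaks of families indexed by natural numbers.\<close>
  obtain e where e: "bij_betw e {0..<card J} J"
    using ex_bij_betw_nat_finite[OF J] by auto
  let ?I = "{0..<card J}"
  have eJ: "e i \<in> J" if "i \<in> ?I" for i using e that by (auto simp: bij_betw_def)
  have "disjoint_family_on (\<lambda>i. A (e i)) ?I"
    using disj e unfolding disjoint_family_on_def bij_betw_def inj_on_def by (metis imageI)
  then have "indep_vars (\<lambda>_. borel) (\<lambda>i. M (A (e i))) ?I"
    using A eJ by (intro M_indep) auto
  then have "indep_vars (\<lambda>_. borel) (\<lambda>i \<omega>. c (e i) * M (A (e i)) \<omega>) ?I"
    by (rule indep_vars_compose2[where Y="\<lambda>i x. c (e i) * x"]) auto
  then have "char (distr P borel (\<lambda>\<omega>. \<Sum>i\<in>?I. c (e i) * M (A (e i)) \<omega>)) z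
    = (\<Prod>i\<in>?I. char (distr P borel (\<lambda>\<omega>. c (e i) * M (A (e i)) \<omega>)) z)"
    by (rule char_distr_sum)
  also have "(\<lambda>\<omega>. \<Sum>i\<in>?I. c (e i) * M (A (e i)) \<omega>) = (\<lambda>\<omega>. \<Sum>j\<in>J. c j * M (A j) \<omega>)"
    using sum.reindex_bij_betw[OF e, of "\<lambda>j. c j * M (A j) _"] by auto
  also have "(\<Prod>i\<in>?I. char (distr P borel (\<lambda>\<omega>. c (e i) * M (A (e i)) \<omega>)) z)
    = (\<Prod>i\<in>?I. complex_of_real (exp (- (measure lborel (A (e i)) * (c (e i) * z)\<^sup>2))))"
    using eJ A M_borel by (intro prod.cong refl) (simp add: char_distr_cmult char_M)
  also have "\<dots> = (\<Prod>j\<in>J. complex_of_real (exp (- (measure lborel (A j) * (c j * z)\<^sup>2))))"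
    by (rule prod.reindex_bij_betw[OF e])
  also have "\<dots> = complex_of_real (exp (- ((\<Sum>j\<in>J. (c j)\<^sup>2 * measure lborel (A j)) * z\<^sup>2)))"
    using J by (simp add: exp_sum[symmetric] sum_negf sum_distrib_right sum_distrib_left power_mult_distrib ac_simps flip: of_real_prod)
  finally show ?thesis .
qed

lemma elementary_fibre:
  fixes f :: "'e \<Rightarrow> real"
  assumes "elementary_integrand f" "y \<noteq> 0"
  shows "f -` {y} \<in> finite_borel_sets"
proof -
  have "f -` {y} \<in> sets borel"
    using assms simple_functionD(2)[of borel f "{y}"] by (simp add: elementary_integrand_def)
  moreover have "emeasure lborel (f -` {y}) \<le> emeasure lborel {x. f x \<noteq> 0}"
  proof (rule emeasure_mono)
    have "{x. f x \<noteq> 0} = f -` (- {0}) \<inter> space borel" by auto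
    then show "{x. f x \<noteq> 0} \<in> sets lborel"
      using assms simple_functionD(2)[of borel f "- {0}"] by (simp add: elementary_integrand_def)
  qed (use assms in auto)
  ultimately show ?thesis
    using assms by (auto simp: finite_borel_sets_def elementary_integrand_def)
qed

lemma finite_range_elementary: "elementary_integrand f \<Longrightarrow> finite (range (f :: 'e \<Rightarrow> real))"
  using simple_functionD(1)[of borel f] by (simp add: elementary_integrand_def)

lemma elementary_borel: "elementary_integrand f \<Longrightarrow> (f :: 'e \<Rightarrow> real) \<in> borel_measurable borel"
  by (simp add: elementary_integrand_def borel_measurable_simple_function)

lemma borel_measurable_elementary_integral:
  assumes "elementary_integrand f"
  shows "elementary_integral M f \<in> borel_measurable P"
  unfolding elementary_integral_def[abs_def] using assms
  by (intro borel_measurable_sum borel_measurable_times borel_measurable_const M_borel elementary_fibre) auto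

lemma elementary_square_integral:
  fixes f :: "'e \<Rightarrow> real"
  assumes f: "elementary_integrand f"
  shows "has_bochner_integral lborel (\<lambda>x. (f x)\<^sup>2) (\<Sum>y\<in>range f - {0}. y\<^sup>2 * measure lborel (f -` {y}))"
proof -
  have eq: "(\<lambda>x. (f x)\<^sup>2) = (\<lambda>x. \<Sum>y\<in>range f - {0}. y\<^sup>2 * indicator (f -` {y}) x)"
  proof
    fix x
    show "(f x)\<^sup>2 = (\<Sum>y\<in>range f - {0}. y\<^sup>2 * indicator (f -` {y}) x)"
    proof (cases "f x = 0")
      case False
      have "(\<Sum>y\<in>range f - {0}. y\<^sup>2 * indicator (f -` {y}) x) = (\<Sum>y\<in>range f - {0}. if y = f x then (f x)\<^sup>2 else 0)"
        by (intro sum.cong) (auto simp: indicator_def)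
      then show ?thesis using False finite_range_elementary[OF f] by simp
    qed (auto simp: indicator_def intro!: sum.neutral)
  qed
  show ?thesis unfolding eq
  proof (intro has_bochner_integral_sum has_bochner_integral_mult_right)
    fix y assume "y \<in> range f - {0}"
    then have "f -` {y} \<in> finite_borel_sets" using elementary_fibre[OF f] by auto
    then show "has_bochner_integral lborel (indicator (f -` {y})) (measure lborel (f -` {y}))"
      by (intro has_bochner_integral_real_indicator) (auto simp: finite_borel_sets_def)
  qed
qed

lemma char_elementary_integral:
  assumes f: "elementary_integrand f"
  shows "char (distr P borel (elementary_integral M f)) z = complex_of_real (exp (- ((\<integral>x. (f x)\<^sup>2 \<partial>lborel) * z\<^sup>2)))"
proof -
  have "char (distr P borel (\<lambda>\<omega>. \<Sum>y\<in>range f - {0}. y * M (f -` {y}) \<omega>)) z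
    = complex_of_real (exp (- ((\<Sum>y\<in>range f - {0}. y\<^sup>2 * measure lborel (f -` {y})) * z\<^sup>2)))"
    using elementary_fibre[OF f] finite_range_elementary[OF f]
    by (intro char_sum_M) (auto simp: disjoint_family_on_def)
  then show ?thesis
    using has_bochner_integral_integral_eq[OF elementary_square_integral[OF f]]
    by (simp add: elementary_integral_def[abs_def])
qed

text \<open>
  An elementary integral can be computed from any finite partition on whose cells the integrand is
  constant. This is finite additivity of \<open>M\<close>, applied to each level set. The cell of \<open>z0\<close>, which may have
  infinite volume, carries the value \<open>0\<close>.
\<close>

lemma elementary_integral_refine:
  fixes k :: "'e \<Rightarrow> 'b" and \<phi> :: "'b \<Rightarrow> real"
  assumes fin: "finite (range k)" and fib: "\<And>y. y \<noteq> z0 \<Longrightarrow> k -` {y} \<in> finite_borel_sets" and z0: "\<phi> z0 = 0"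
  shows "AE \<omega> in P. elementary_integral M (\<lambda>x. \<phi> (k x)) \<omega> = (\<Sum>y\<in>range k - {z0}. \<phi> y * M (k -` {y}) \<omega>)"
proof -
  let ?J = "range k - {z0}" and ?f = "\<lambda>x. \<phi> (k x)"
  let ?C = "range ?f - {0}"
  have finJ: "finite ?J" using fin by simp
  have finC: "finite ?C" using fin by (simp add: finite_imageI[of "range k" \<phi>, unfolded image_image])
  have "AE \<omega> in P. \<forall>c\<in>?C. M (?f -` {c}) \<omega> = (\<Sum>y\<in>{y\<in>?J. \<phi> y = c}. M (k -` {y}) \<omega>)"
  proof (rule AE_finite_allI[OF finC])
    fix c assume c: "c \<in> ?C"
    have eq: "?f -` {c} = (\<Union>y\<in>{y\<in>?J. \<phi> y = c}. k -` {y})"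
      using c z0 by auto
    show "AE \<omega> in P. M (?f -` {c}) \<omega> = (\<Sum>y\<in>{y\<in>?J. \<phi> y = c}. M (k -` {y}) \<omega>)"
      unfolding eq using finJ fib by (intro AE_M_UN) (auto simp: disjoint_family_on_def)
  qed
  then show ?thesis
  proof eventually_elim
    fix \<omega> assume *: "\<forall>c\<in>?C. M (?f -` {c}) \<omega> = (\<Sum>y\<in>{y\<in>?J. \<phi> y = c}. M (k -` {y}) \<omega>)"
    have "elementary_integral M ?f \<omega> = (\<Sum>c\<in>?C. \<Sum>y\<in>{y\<in>{y\<in>?J. \<phi> y \<noteq> 0}. \<phi> y = c}. \<phi> y * M (k -` {y}) \<omega>)"
      unfolding elementary_integral_def
    proof (intro sum.cong refl)
      fix c assume c: "c \<in> ?C"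
      have "c * M (?f -` {c}) \<omega> = (\<Sum>y\<in>{y\<in>?J. \<phi> y = c}. \<phi> y * M (k -` {y}) \<omega>)"
        using * c by (simp add: sum_distrib_left)
      also have "{y\<in>?J. \<phi> y = c} = {y\<in>{y\<in>?J. \<phi> y \<noteq> 0}. \<phi> y = c}"
        using c by auto
      finally show "c * M (?f -` {c}) \<omega> = (\<Sum>y\<in>{y\<in>{y\<in>?J. \<phi> y \<noteq> 0}. \<phi> y = c}. \<phi> y * M (k -` {y}) \<omega>)" .
    qed
    also have "\<dots> = (\<Sum>y\<in>{y\<in>?J. \<phi> y \<noteq> 0}. \<phi> y * M (k -` {y}) \<omega>)"
      using finJ finC by (intro sum.group) auto
    also have "\<dots> = (\<Sum>y\<in>?J. \<phi> y * M (k -` {y}) \<omega>)"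
      using finJ by (intro sum.mono_neutral_left) auto
    finally show "elementary_integral M ?f \<omega> = (\<Sum>y\<in>?J. \<phi> y * M (k -` {y}) \<omega>)" .
  qed
qed

text \<open>
  Both integrands are constant on the level sets of \<open>x \<mapsto> (f x, g x)\<close>, so all three integrals can be read
  off from this common partition.
\<close>

lemma elementary_lincomb:
  fixes f g :: "'e \<Rightarrow> real"
  assumes f: "elementary_integrand f" and g: "elementary_integrand g"
  shows "elementary_integrand (\<lambda>x. a * f x + b * g x)"
    and "AE \<omega> in P. elementary_integral M (\<lambda>x. a * f x + b * g x) \<omega>
      = a * elementary_integral M f \<omega> + b * elementary_integral M g \<omega>"
proof -
  have [measurable]: "f \<in> borel_measurable borel" "g \<in> borel_measurable borel"
    using f g by (auto intro: elementary_borel)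
  show "elementary_integrand (\<lambda>x. a * f x + b * g x)"
    unfolding elementary_integrand_def
  proof
    show "simple_function borel (\<lambda>x. a * f x + b * g x)"
      using f g by (intro simple_function_add simple_function_mult) (auto simp: elementary_integrand_def)
    have "emeasure lborel {x. a * f x + b * g x \<noteq> 0} \<le> emeasure lborel ({x. f x \<noteq> 0} \<union> {x. g x \<noteq> 0})"
      by (intro emeasure_mono) auto
    also have "\<dots> \<le> emeasure lborel {x. f x \<noteq> 0} + emeasure lborel {x. g x \<noteq> 0}"
      by (intro emeasure_subadditive) auto
    also have "\<dots> < \<infinity>"
      using f g by (auto simp: elementary_integrand_def)
    finally show "emeasure lborel {x. a * f x + b * g x \<noteq> 0} < \<infinity>" .
  qed
  let ?k = "\<lambda>x. (f x, g x)"
  have fin: "finite (range ?k)"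
    by (rule finite_subset[of _ "range f \<times> range g"])
      (use finite_range_elementary[OF f] finite_range_elementary[OF g] in auto)
  have fib: "?k -` {y} \<in> finite_borel_sets" if "y \<noteq> (0, 0)" for y
  proof -
    obtain u v where y: "y = (u, v)" by (cases y)
    have eq: "?k -` {y} = f -` {u} \<inter> g -` {v}" by (auto simp: y)
    have s: "f -` {u} \<in> sets lborel" "g -` {v} \<in> sets lborel"
      using measurable_sets[of f borel borel "{u}"] measurable_sets[of g borel borel "{v}"] by auto
    show ?thesis
    proof (cases "u = 0")
      case False
      then have "f -` {u} \<in> finite_borel_sets" by (rule elementary_fibre[OF f])
      then show ?thesis
        using emeasure_mono[OF Int_lower1 s(1), of "g -` {v}"] s unfolding eq
        by (auto simp: finite_borel_sets_def order_le_less_trans)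
    next
      case True
      then have "v \<noteq> 0" using that y by auto
      then have "g -` {v} \<in> finite_borel_sets" by (rule elementary_fibre[OF g])
      then show ?thesis
        using emeasure_mono[OF Int_lower2 s(2), of "f -` {u}"] s unfolding eq
        by (auto simp: finite_borel_sets_def order_le_less_trans)
    qed
  qed
  have "AE \<omega> in P. elementary_integral M f \<omega> = (\<Sum>y\<in>range ?k - {(0, 0)}. fst y * M (?k -` {y}) \<omega>)"
    using elementary_integral_refine[OF fin fib, of "(0, 0)" fst] by simp
  moreover have "AE \<omega> in P. elementary_integral M g \<omega> = (\<Sum>y\<in>range ?k - {(0, 0)}. snd y * M (?k -` {y}) \<omega>)"
    using elementary_integral_refine[OF fin fib, of "(0, 0)" snd] by simp
  moreover have "AE \<omega> in P. elementary_integral M (\<lambda>x. a * f x + b * g x) \<omega>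
    = (\<Sum>y\<in>range ?k - {(0, 0)}. (a * fst y + b * snd y) * M (?k -` {y}) \<omega>)"
    using elementary_integral_refine[OF fin fib, of "(0, 0)" "\<lambda>y. a * fst y + b * snd y"] by simp
  ultimately show "AE \<omega> in P. elementary_integral M (\<lambda>x. a * f x + b * g x) \<omega>
      = a * elementary_integral M f \<omega> + b * elementary_integral M g \<omega>"
    by eventually_elim (simp add: sum.distrib sum_distrib_left algebra_simps)
qed

end

section \<open>Normal laws and convergence of second moments\<close>

lemma norm_integral_le:
  fixes f :: "'a \<Rightarrow> 'b::{banach,second_countable_topology}"
  assumes "integrable M f" "integrable M g" "\<And>x. x \<in> space M \<Longrightarrow> norm (f x) \<le> g x"
  shows "norm (\<integral>x. f x \<partial>M) \<le> (\<integral>x. g x \<partial>M)"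
  using assms by (intro order_trans[OF integral_norm_bound integral_mono]) auto

lemma AE_return_real_0: "AE x in return borel (0::real). x = 0"
  by (subst AE_return) auto

text \<open>
  Levy's uniqueness theorem identifies the law: the point mass at \<open>0\<close> if \<open>v = 0\<close>, and the centred
  normal law with variance \<open>2 v\<close> otherwise.
\<close>

lemma (in prob_space) gaussian_of_char:
  assumes X [measurable]: "X \<in> borel_measurable M" and "0 \<le> v"
    and char: "\<And>z. char (distr M borel X) z = complex_of_real (exp (- (v * z\<^sup>2)))"
  shows "gaussian_variable M X" and "expectation X = 0"
    and "integrable M (\<lambda>\<omega>. (X \<omega>)\<^sup>2)" and "expectation (\<lambda>\<omega>. (X \<omega>)\<^sup>2) = 2 * v"
proof -
  have "gaussian_variable M X \<and> expectation X = 0 \<and> integrable M (\<lambda>\<omega>. (X \<omega>)\<^sup>2) \<and> expectation (\<lambda>\<omega>. (X \<omega>)\<^sup>2) = 2 * v"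
  proof (cases "v = 0")
    case True
    have dirac: "real_distribution (return borel (0::real))"
      unfolding real_distribution_def real_distribution_axioms_def by (auto intro: prob_space_return)
    have "distr M borel X = return borel 0"
    proof (rule Levy_uniqueness)
      show "char (distr M borel X) = char (return borel 0)"
      proof
        fix z
        have "char (return borel 0) z = 1"
          unfolding char_def by (subst integral_return) auto
        then show "char (distr M borel X) z = char (return borel 0) z"
          by (simp add: char True)
      qed
    qed (auto intro: dirac real_distribution_distr)
    then have "AE x in distr M borel X. x = 0"
      using AE_return_real_0 by (simp only:)
    then have ae: "AE \<omega> in M. X \<omega> = 0"
      by (subst (asm) AE_distr_iff) auto
    have "expectation X = expectation (\<lambda>_. 0)"
      using ae by (intro integral_cong_AE) auto
    moreover have "expectation (\<lambda>\<omega>. (X \<omega>)\<^sup>2) = expectation (\<lambda>_. 0)"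
      using ae by (intro integral_cong_AE) auto
    moreover have "integrable M (\<lambda>\<omega>. (X \<omega>)\<^sup>2) \<longleftrightarrow> integrable M (\<lambda>_. 0::real)"
      using ae by (intro integrable_cong_AE) auto
    ultimately show ?thesis
      using ae True by (auto simp: gaussian_variable_def)
  next
    case False
    define \<sigma> where "\<sigma> = sqrt (2 * v)"
    have \<sigma>: "0 < \<sigma>" "\<sigma>\<^sup>2 = 2 * v" using False \<open>0 \<le> v\<close> by (auto simp: \<sigma>_def)
    let ?N = "density lborel (normal_density 0 \<sigma>)"
    have "distr M borel X = ?N"
    proof (rule Levy_uniqueness)
      show "real_distribution ?N"
        unfolding real_distribution_def real_distribution_axioms_def
        using prob_space_normal_density[OF \<sigma>(1)] by auto
      show "char (distr M borel X) = char ?N"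
      proof
        fix z
        have "char ?N z = (\<integral>x. iexp (z * x) * complex_of_real (normal_density 0 \<sigma> x) \<partial>lborel)"
          unfolding char_def by (subst integral_density) (auto simp: scaleR_conv_of_real mult.commute)
        also have "\<dots> = complex_of_real (exp (- (v * z\<^sup>2)))"
          unfolding fourier_normal_density[OF \<sigma>(1)] using \<sigma>(2) by (simp add: power_mult_distrib)
        finally show "char (distr M borel X) z = char ?N z" by (simp add: char)
      qed
    qed (auto intro: real_distribution_distr)
    then have D: "distributed M lborel X (normal_density 0 \<sigma>)"
      unfolding distributed_def by (auto cong: distr_cong)
    have e: "expectation X = 0"
      by (rule normal_distributed_expectation[OF \<sigma>(1) D])
    have "integrable M (\<lambda>\<omega>. (X \<omega>)\<^sup>2)"
      using integrable_normal_moment[OF \<sigma>(1), of 0 2] distributed_integrable[OF D, of "\<lambda>x. x\<^sup>2"] by simp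
    moreover have "expectation (\<lambda>\<omega>. (X \<omega>)\<^sup>2) = 2 * v"
      using normal_distributed_variance[OF \<sigma>(1) D] e \<sigma>(2) by simp
    ultimately show ?thesis
      using e D \<sigma>(1) by (auto simp: gaussian_variable_def)
  qed
  then show "gaussian_variable M X" and "expectation X = 0"
    and "integrable M (\<lambda>\<omega>. (X \<omega>)\<^sup>2)" and "expectation (\<lambda>\<omega>. (X \<omega>)\<^sup>2) = 2 * v" by auto
qed

lemma norm_iexp_diff: "norm (iexp a - iexp b) \<le> \<bar>a - b\<bar>"
proof -
  have "norm (iexp a - iexp b) = norm (iexp b * (iexp (a - b) - 1))"
    by (simp add: algebra_simps exp_diff)
  also have "\<dots> = norm (iexp (a - b) - 1)" by (simp only: norm_mult norm_exp_i_times mult_1)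
  also have "\<dots> \<le> \<bar>a - b\<bar>" using iexp_approx1[of "a - b" 0] by simp
  finally show ?thesis .
qed

text \<open>
  The difference of the exponentials is at most \<open>|z| \<epsilon>\<close> where the variables differ by at most \<open>\<epsilon>\<close>, and at
  most \<open>2\<close> elsewhere.
\<close>

lemma (in prob_space) char_tendsto_of_tendsto_in_probability:
  fixes X :: "nat \<Rightarrow> 'a \<Rightarrow> real"
  assumes [measurable]: "\<And>n. X n \<in> borel_measurable M" "Y \<in> borel_measurable M"
    and conv: "\<And>\<epsilon>. 0 < \<epsilon> \<Longrightarrow> (\<lambda>n. prob {\<omega>\<in>space M. \<bar>X n \<omega> - Y \<omega>\<bar> > \<epsilon>}) \<longlonglongrightarrow> 0"
  shows "(\<lambda>n. char (distr M borel (X n)) z) \<longlonglongrightarrow> char (distr M borel Y) z"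
proof (rule tendstoI)
  fix e :: real assume e: "0 < e"
  define \<epsilon> where "\<epsilon> = e / (2 * (\<bar>z\<bar> + 1))"
  have \<epsilon>: "0 < \<epsilon>" "\<bar>z\<bar> * \<epsilon> < e / 2"
    using e by (auto simp: \<epsilon>_def field_simps)
  let ?B = "\<lambda>n. {\<omega>\<in>space M. \<bar>X n \<omega> - Y \<omega>\<bar> > \<epsilon>}"
  have bound: "dist (char (distr M borel (X n)) z) (char (distr M borel Y) z) \<le> \<bar>z\<bar> * \<epsilon> + 2 * prob (?B n)" for n
  proof -
    have int: "integrable M (\<lambda>\<omega>. iexp (z * Z \<omega>))" if "Z \<in> borel_measurable M" for Z :: "'a \<Rightarrow> real"
      using that by (intro integrable_const_bound[where B=1]) auto
    have "dist (char (distr M borel (X n)) z) (char (distr M borel Y) z)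
      = norm (CLINT \<omega>|M. iexp (z * X n \<omega>) - iexp (z * Y \<omega>))"
      by (subst Bochner_Integration.integral_diff[OF int int]) (auto simp: dist_norm char_def integral_distr)
    also have "\<dots> \<le> (\<integral>\<omega>. \<bar>z\<bar> * \<epsilon> + 2 * indicator (?B n) \<omega> \<partial>M)"
    proof (rule norm_integral_le)
      show "integrable M (\<lambda>\<omega>. iexp (z * X n \<omega>) - iexp (z * Y \<omega>))"
        by (intro Bochner_Integration.integrable_diff int) auto
      show "integrable M (\<lambda>\<omega>. \<bar>z\<bar> * \<epsilon> + 2 * indicator (?B n) \<omega>)"
        by (intro Bochner_Integration.integrable_add integrable_mult_right) (auto simp: less_top[symmetric])
      fix \<omega> assume "\<omega> \<in> space M"
      show "norm (iexp (z * X n \<omega>) - iexp (z * Y \<omega>)) \<le> \<bar>z\<bar> * \<epsilon> + 2 * indicator (?B n) \<omega>"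
      proof (cases "\<bar>X n \<omega> - Y \<omega>\<bar> > \<epsilon>")
        case True
        have "norm (iexp (z * X n \<omega>) - iexp (z * Y \<omega>)) \<le> norm (iexp (z * X n \<omega>)) + norm (iexp (z * Y \<omega>))"
          by (rule norm_triangle_ineq4)
        also have "\<dots> = 2" by (simp only: norm_exp_i_times)
        finally show ?thesis using True \<open>\<omega> \<in> space M\<close> \<epsilon>(1) by (simp add: indicator_def add_increasing)
      next
        case False
        have "norm (iexp (z * X n \<omega>) - iexp (z * Y \<omega>)) \<le> \<bar>z\<bar> * \<bar>X n \<omega> - Y \<omega>\<bar>"
          using norm_iexp_diff[of "z * X n \<omega>" "z * Y \<omega>"] by (simp add: abs_mult flip: right_diff_distrib)
        also have "\<dots> \<le> \<bar>z\<bar> * \<epsilon>" using False by (intro mult_left_mono) auto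
        finally show ?thesis using False by simp
      qed
    qed
    also have "\<dots> = \<bar>z\<bar> * \<epsilon> + 2 * prob (?B n)"
      by (subst Bochner_Integration.integral_add) (auto simp: prob_space less_top[symmetric])
    finally show ?thesis .
  qed
  have "\<forall>\<^sub>F n in sequentially. prob (?B n) < e / 4"
    by (rule order_tendstoD(2)[OF conv[OF \<epsilon>(1)]]) (use e in simp)
  then show "\<forall>\<^sub>F n in sequentially. dist (char (distr M borel (X n)) z) (char (distr M borel Y) z) < e"
  proof eventually_elim
    fix n assume "prob (?B n) < e / 4"
    then show "dist (char (distr M borel (X n)) z) (char (distr M borel Y) z) < e"
      using bound[of n] \<epsilon>(2) by linarith
  qed
qed

lemma square_le_double: "(a + b)\<^sup>2 \<le> 2 * a\<^sup>2 + 2 * (b::real)\<^sup>2"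
  using sum_squares_bound[of a b] by (simp add: power2_sum)

text \<open>
  The bound \<open>2 |f g| \<le> \<delta> f\<^sup>2 + g\<^sup>2 / \<delta>\<close> with \<open>g = F n - f\<close> replaces the triangle inequality
  of the \<open>L\<^sup>2\<close> norm.
\<close>

lemma L2_tendsto:
  fixes F :: "nat \<Rightarrow> 'e \<Rightarrow> real"
  assumes [measurable]: "\<And>n. F n \<in> borel_measurable N" "f \<in> borel_measurable N"
    and F: "\<And>n. integrable N (\<lambda>x. (F n x)\<^sup>2)"
    and conv: "(\<lambda>n. \<integral>\<^sup>+x. ennreal ((F n x - f x)\<^sup>2) \<partial>N) \<longlonglongrightarrow> 0"
  shows "integrable N (\<lambda>x. (f x)\<^sup>2)"
    and "(\<lambda>n. \<integral>x. (F n x)\<^sup>2 \<partial>N) \<longlonglongrightarrow> (\<integral>x. (f x)\<^sup>2 \<partial>N)"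
proof -
  have ev: "\<forall>\<^sub>F n in sequentially. (\<integral>\<^sup>+x. ennreal ((F n x - f x)\<^sup>2) \<partial>N) < 1"
    using conv by (rule order_tendstoD) simp
  then obtain n0 where "(\<integral>\<^sup>+x. ennreal ((F n0 x - f x)\<^sup>2) \<partial>N) < 1"
    by (auto simp: eventually_sequentially)
  then have "integrable N (\<lambda>x. (F n0 x - f x)\<^sup>2)"
    by (intro integrableI_nonneg) (auto intro: less_trans)
  then have "integrable N (\<lambda>x. 2 * (F n0 x)\<^sup>2 + 2 * (F n0 x - f x)\<^sup>2)"
    using F by auto
  then show f: "integrable N (\<lambda>x. (f x)\<^sup>2)"
  proof (rule Bochner_Integration.integrable_bound)
    show "AE x in N. norm ((f x)\<^sup>2) \<le> norm (2 * (F n0 x)\<^sup>2 + 2 * (F n0 x - f x)\<^sup>2)"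
    proof (rule AE_I2)
      fix x
      show "norm ((f x)\<^sup>2) \<le> norm (2 * (F n0 x)\<^sup>2 + 2 * (F n0 x - f x)\<^sup>2)"
        using square_le_double[of "F n0 x" "f x - F n0 x"] by (simp add: power2_commute)
    qed
  qed simp
  have dint: "integrable N (\<lambda>x. (F n x - f x)\<^sup>2)" for n
  proof (rule Bochner_Integration.integrable_bound)
    show "integrable N (\<lambda>x. 2 * (F n x)\<^sup>2 + 2 * (f x)\<^sup>2)" using F f by auto
    show "AE x in N. norm ((F n x - f x)\<^sup>2) \<le> norm (2 * (F n x)\<^sup>2 + 2 * (f x)\<^sup>2)"
    proof (rule AE_I2)
      fix x
      show "norm ((F n x - f x)\<^sup>2) \<le> norm (2 * (F n x)\<^sup>2 + 2 * (f x)\<^sup>2)"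
        using square_le_double[of "F n x" "- f x"] by simp
    qed
  qed measurable
  let ?d = "\<lambda>n. \<integral>x. (F n x - f x)\<^sup>2 \<partial>N" and ?N = "\<integral>x. (f x)\<^sup>2 \<partial>N"
  have d: "?d \<longlonglongrightarrow> 0"
  proof -
    have "(\<lambda>n. ennreal (?d n)) \<longlonglongrightarrow> ennreal 0"
      using conv dint by (subst (asm) nn_integral_eq_integral) auto
    then show ?thesis by (subst (asm) tendsto_ennreal_iff) auto
  qed
  have N0: "0 \<le> ?N" by simp
  have bound: "\<bar>(\<integral>x. (F n x)\<^sup>2 \<partial>N) - ?N\<bar> \<le> (1 + 1 / \<delta>) * ?d n + \<delta> * ?N" if "0 < \<delta>" for n \<delta>
  proof -
    have "\<bar>(\<integral>x. (F n x)\<^sup>2 \<partial>N) - ?N\<bar> = norm (\<integral>x. (F n x)\<^sup>2 - (f x)\<^sup>2 \<partial>N)"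
      using F f by simp
    also have "\<dots> \<le> (\<integral>x. (1 + 1 / \<delta>) * (F n x - f x)\<^sup>2 + \<delta> * (f x)\<^sup>2 \<partial>N)"
    proof (rule norm_integral_le)
      fix x
      let ?g = "F n x - f x"
      have "0 \<le> (\<delta> * \<bar>f x\<bar> - \<bar>?g\<bar>)\<^sup>2 / \<delta>" using that by simp
      then have "2 * \<bar>f x\<bar> * \<bar>?g\<bar> \<le> \<delta> * (f x)\<^sup>2 + ?g\<^sup>2 / \<delta>"
        using that by (simp add: power2_diff power_mult_distrib field_simps power2_eq_square)
      moreover have "(F n x)\<^sup>2 - (f x)\<^sup>2 = ?g\<^sup>2 + 2 * f x * ?g"
        by (simp add: power2_eq_square algebra_simps)
      moreover have "\<bar>2 * f x * ?g\<bar> = 2 * \<bar>f x\<bar> * \<bar>?g\<bar>" by (simp add: abs_mult)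
      moreover have "(1 + 1 / \<delta>) * ?g\<^sup>2 = ?g\<^sup>2 + ?g\<^sup>2 / \<delta>" by (simp add: distrib_right)
      moreover have "0 \<le> ?g\<^sup>2" by simp
      ultimately show "norm ((F n x)\<^sup>2 - (f x)\<^sup>2) \<le> (1 + 1 / \<delta>) * ?g\<^sup>2 + \<delta> * (f x)\<^sup>2"
        unfolding real_norm_def by linarith
    qed (use F f dint in auto)
    also have "\<dots> = (1 + 1 / \<delta>) * ?d n + \<delta> * ?N"
      using f dint by simp
    finally show ?thesis .
  qed
  show "(\<lambda>n. \<integral>x. (F n x)\<^sup>2 \<partial>N) \<longlonglongrightarrow> ?N"
  proof (rule tendstoI)
    fix e :: real assume e: "0 < e"
    define \<delta> where "\<delta> = e / (2 * (?N + 1))"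
    have \<delta>: "0 < \<delta>" using e N0 by (simp add: \<delta>_def add_nonneg_pos)
    have \<delta>N: "\<delta> * ?N < e / 2"
    proof -
      have "\<delta> * ?N < \<delta> * (?N + 1)" using \<delta> by simp
      also have "\<dots> = e / 2"
      proof -
        have "e / (2 * k) * k = e / 2" if "k \<noteq> 0" for k :: real using that by simp
        then show ?thesis unfolding \<delta>_def using N0 by (metis add_nonneg_eq_0_iff zero_le_one zero_neq_one)
      qed
      finally show ?thesis .
    qed
    have "(\<lambda>n. (1 + 1 / \<delta>) * ?d n) \<longlonglongrightarrow> (1 + 1 / \<delta>) * 0" by (intro tendsto_mult tendsto_const d)
    then have "\<forall>\<^sub>F n in sequentially. (1 + 1 / \<delta>) * ?d n < e / 2"
      using e by (intro order_tendstoD(2)) auto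
    then show "\<forall>\<^sub>F n in sequentially. dist (\<integral>x. (F n x)\<^sup>2 \<partial>N) ?N < e"
    proof eventually_elim
      fix n assume "(1 + 1 / \<delta>) * ?d n < e / 2"
      then show "dist (\<integral>x. (F n x)\<^sup>2 \<partial>N) ?N < e"
        using bound[OF \<delta>, of n] \<delta>N unfolding dist_real_def by linarith
    qed
  qed
qed

section \<open>Stable integrals of square integrable functions\<close>

context gaussian_random_measure begin

abbreviation elem where "elem \<equiv> elementary_integral M"

lemma has_stable_integral_1_iff:
  "has_stable_integral 1 P M f X \<longleftrightarrow>
    f \<in> borel_measurable borel \<and> X \<in> borel_measurable P \<and>
    (\<exists>F. (\<forall>n. elementary_integrand (F n)) \<and>
       (\<lambda>n. \<integral>\<^sup>+x. ennreal ((F n x - f x)\<^sup>2) \<partial>lborel) \<longlonglongrightarrow> 0 \<and>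
       (\<forall>\<epsilon>>0. (\<lambda>n. prob {\<omega> \<in> space P. \<bar>elem (F n) \<omega> - X \<omega>\<bar> > \<epsilon>}) \<longlonglongrightarrow> 0))"
  by (simp add: has_stable_integral_def)

text \<open>
  The elementary integrals of the approximants are centred normal with variances converging to
  \<open>2 \<integral> f\<^sup>2\<close>, and convergence in probability carries the characteristic functions to the limit.
\<close>

lemma has_stable_integral_char:
  assumes "has_stable_integral 1 P M f X"
  shows "integrable lborel (\<lambda>x. (f x)\<^sup>2)"
    and "char (distr P borel X) z = complex_of_real (exp (- ((\<integral>x. (f x)\<^sup>2 \<partial>lborel) * z\<^sup>2)))"
proof -
  obtain F where f: "f \<in> borel_measurable borel" and X: "X \<in> borel_measurable P"
    and F: "\<And>n. elementary_integrand (F n)"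
    and L2: "(\<lambda>n. \<integral>\<^sup>+x. ennreal ((F n x - f x)\<^sup>2) \<partial>lborel) \<longlonglongrightarrow> 0"
    and pr: "\<And>\<epsilon>. 0 < \<epsilon> \<Longrightarrow> (\<lambda>n. prob {\<omega> \<in> space P. \<bar>elem (F n) \<omega> - X \<omega>\<bar> > \<epsilon>}) \<longlonglongrightarrow> 0"
    using assms unfolding has_stable_integral_1_iff by blast
  have int: "integrable lborel (\<lambda>x. (F n x)\<^sup>2)" for n
    using elementary_square_integral[OF F] by (rule integrable.intros)
  note L = L2_tendsto[of F lborel f, OF _ _ int L2]
  show "integrable lborel (\<lambda>x. (f x)\<^sup>2)"
    using f elementary_borel[OF F] by (intro L(1)) auto
  have conv: "(\<lambda>n. \<integral>x. (F n x)\<^sup>2 \<partial>lborel) \<longlonglongrightarrow> (\<integral>x. (f x)\<^sup>2 \<partial>lborel)"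
    using f elementary_borel[OF F] by (intro L(2)) auto
  have "(\<lambda>n. char (distr P borel (elem (F n))) z) \<longlonglongrightarrow> char (distr P borel X) z"
    by (rule char_tendsto_of_tendsto_in_probability[OF borel_measurable_elementary_integral[OF F] X pr])
  moreover have "(\<lambda>n. char (distr P borel (elem (F n))) z) \<longlonglongrightarrow> complex_of_real (exp (- ((\<integral>x. (f x)\<^sup>2 \<partial>lborel) * z\<^sup>2)))"
    unfolding char_elementary_integral[OF F] by (intro tendsto_intros conv)
  ultimately show "char (distr P borel X) z = complex_of_real (exp (- ((\<integral>x. (f x)\<^sup>2 \<partial>lborel) * z\<^sup>2)))"
    by (rule LIMSEQ_unique)
qed

lemma has_stable_integral_0: "has_stable_integral 1 P M (\<lambda>x. 0) (\<lambda>\<omega>. 0)"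
  unfolding has_stable_integral_1_iff
  by (intro conjI exI[of _ "\<lambda>n x. 0"]) (auto simp: elementary_integrand_def elementary_integral_def)

lemma has_stable_integral_AE_cong:
  assumes "has_stable_integral 1 P M f X" and [measurable]: "Y \<in> borel_measurable P" and ae: "AE \<omega> in P. Y \<omega> = X \<omega>"
  shows "has_stable_integral 1 P M f Y"
proof -
  obtain F where f: "f \<in> borel_measurable borel" and X [measurable]: "X \<in> borel_measurable P"
    and F: "\<And>n. elementary_integrand (F n)"
    and L2: "(\<lambda>n. \<integral>\<^sup>+x. ennreal ((F n x - f x)\<^sup>2) \<partial>lborel) \<longlonglongrightarrow> 0"
    and pr: "\<And>\<epsilon>. 0 < \<epsilon> \<Longrightarrow> (\<lambda>n. prob {\<omega> \<in> space P. \<bar>elem (F n) \<omega> - X \<omega>\<bar> > \<epsilon>}) \<longlonglongrightarrow> 0"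
    using assms unfolding has_stable_integral_1_iff by blast
  have [measurable]: "elem (F n) \<in> borel_measurable P" for n
    by (rule borel_measurable_elementary_integral[OF F])
  have "prob {\<omega> \<in> space P. \<bar>elem (F n) \<omega> - Y \<omega>\<bar> > \<epsilon>} = prob {\<omega> \<in> space P. \<bar>elem (F n) \<omega> - X \<omega>\<bar> > \<epsilon>}" for n \<epsilon>
    using ae by (intro finite_measure_eq_AE) auto
  then show ?thesis
    unfolding has_stable_integral_1_iff using f F L2 pr by (intro conjI exI[of _ F]) auto
qed

text \<open>
  Linear combinations of approximating sequences approximate the linear combination, in \<open>L\<^sup>2\<close> by
  \<open>square_le_double\<close> and in probability because a large deviation of the sum forces one of the summands.
\<close>

lemma has_stable_integral_lincomb:
  assumes f: "has_stable_integral 1 P M f X" and g: "has_stable_integral 1 P M g Y"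
  shows "has_stable_integral 1 P M (\<lambda>x. a * f x + b * g x) (\<lambda>\<omega>. a * X \<omega> + b * Y \<omega>)"
proof -
  obtain F where mf [measurable]: "f \<in> borel_measurable borel" and X [measurable]: "X \<in> borel_measurable P"
    and F: "\<And>n. elementary_integrand (F n)"
    and LF: "(\<lambda>n. \<integral>\<^sup>+x. ennreal ((F n x - f x)\<^sup>2) \<partial>lborel) \<longlonglongrightarrow> 0"
    and pF: "\<And>\<epsilon>. 0 < \<epsilon> \<Longrightarrow> (\<lambda>n. prob {\<omega> \<in> space P. \<bar>elem (F n) \<omega> - X \<omega>\<bar> > \<epsilon>}) \<longlonglongrightarrow> 0"
    using f unfolding has_stable_integral_1_iff by blast
  obtain G where mg [measurable]: "g \<in> borel_measurable borel" and Y [measurable]: "Y \<in> borel_measurable P"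
    and G: "\<And>n. elementary_integrand (G n)"
    and LG: "(\<lambda>n. \<integral>\<^sup>+x. ennreal ((G n x - g x)\<^sup>2) \<partial>lborel) \<longlonglongrightarrow> 0"
    and pG: "\<And>\<epsilon>. 0 < \<epsilon> \<Longrightarrow> (\<lambda>n. prob {\<omega> \<in> space P. \<bar>elem (G n) \<omega> - Y \<omega>\<bar> > \<epsilon>}) \<longlonglongrightarrow> 0"
    using g unfolding has_stable_integral_1_iff by blast
  have [measurable]: "elem (F n) \<in> borel_measurable P" "elem (G n) \<in> borel_measurable P" for n
    by (auto intro: borel_measurable_elementary_integral F G)
  have [measurable]: "F n \<in> borel_measurable borel" "G n \<in> borel_measurable borel" for n
    by (auto intro: elementary_borel F G)
  let ?H = "\<lambda>n x. a * F n x + b * G n x"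
  let ?h = "\<lambda>x. a * f x + b * g x" and ?Z = "\<lambda>\<omega>. a * X \<omega> + b * Y \<omega>"
  have H: "elementary_integrand (?H n)" for n
    by (rule elementary_lincomb(1)[OF F G])
  have [measurable]: "elem (?H n) \<in> borel_measurable P" for n
    by (rule borel_measurable_elementary_integral[OF H])
  have "(\<lambda>n. \<integral>\<^sup>+x. ennreal ((?H n x - ?h x)\<^sup>2) \<partial>lborel) \<longlonglongrightarrow> 0"
  proof (rule tendsto_sandwich[OF _ _ tendsto_const])
    let ?u = "\<lambda>n. ennreal (2 * a\<^sup>2) * (\<integral>\<^sup>+x. ennreal ((F n x - f x)\<^sup>2) \<partial>lborel)
        + ennreal (2 * b\<^sup>2) * (\<integral>\<^sup>+x. ennreal ((G n x - g x)\<^sup>2) \<partial>lborel)"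
    have "(\<integral>\<^sup>+x. ennreal ((?H n x - ?h x)\<^sup>2) \<partial>lborel) \<le> ?u n" for n
    proof -
      have "(\<integral>\<^sup>+x. ennreal ((?H n x - ?h x)\<^sup>2) \<partial>lborel)
        \<le> (\<integral>\<^sup>+x. ennreal (2 * a\<^sup>2) * ennreal ((F n x - f x)\<^sup>2) + ennreal (2 * b\<^sup>2) * ennreal ((G n x - g x)\<^sup>2) \<partial>lborel)"
      proof (rule nn_integral_mono)
        fix x
        have "?H n x - ?h x = a * (F n x - f x) + b * (G n x - g x)"
          by (simp add: algebra_simps)
        then have "(?H n x - ?h x)\<^sup>2 \<le> 2 * a\<^sup>2 * (F n x - f x)\<^sup>2 + 2 * b\<^sup>2 * (G n x - g x)\<^sup>2"
          using square_le_double[of "a * (F n x - f x)" "b * (G n x - g x)"]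
          by (simp only: power_mult_distrib mult.assoc)
        then show "ennreal ((?H n x - ?h x)\<^sup>2)
          \<le> ennreal (2 * a\<^sup>2) * ennreal ((F n x - f x)\<^sup>2) + ennreal (2 * b\<^sup>2) * ennreal ((G n x - g x)\<^sup>2)"
          by (simp add: ennreal_leI flip: ennreal_mult ennreal_plus)
      qed
      also have "\<dots> = ?u n"
        by (subst nn_integral_add) (auto simp: nn_integral_cmult)
      finally show ?thesis .
    qed
    then show "\<forall>\<^sub>F n in sequentially. (\<integral>\<^sup>+x. ennreal ((?H n x - ?h x)\<^sup>2) \<partial>lborel) \<le> ?u n"
      by simp
    have "?u \<longlonglongrightarrow> ennreal (2 * a\<^sup>2) * 0 + ennreal (2 * b\<^sup>2) * 0"
      by (intro tendsto_add ennreal_tendsto_cmult LF LG) auto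
    then show "?u \<longlonglongrightarrow> 0" by simp
  qed simp
  moreover have "(\<lambda>n. prob {\<omega> \<in> space P. \<bar>elem (?H n) \<omega> - ?Z \<omega>\<bar> > \<epsilon>}) \<longlonglongrightarrow> 0" if \<epsilon>: "0 < \<epsilon>" for \<epsilon>
  proof (rule tendsto_sandwich[OF _ _ tendsto_const])
    define \<delta> where "\<delta> = \<epsilon> / (2 * (\<bar>a\<bar> + \<bar>b\<bar> + 1))"
    have \<delta>: "0 < \<delta>" using \<epsilon> by (simp add: \<delta>_def)
    have \<delta>2: "(\<bar>a\<bar> + \<bar>b\<bar>) * \<delta> \<le> \<epsilon>"
      using \<epsilon> by (simp add: \<delta>_def field_simps)
    let ?BF = "\<lambda>n. {\<omega> \<in> space P. \<bar>elem (F n) \<omega> - X \<omega>\<bar> > \<delta>}" and ?BG = "\<lambda>n. {\<omega> \<in> space P. \<bar>elem (G n) \<omega> - Y \<omega>\<bar> > \<delta>}"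
    have "prob {\<omega> \<in> space P. \<bar>elem (?H n) \<omega> - ?Z \<omega>\<bar> > \<epsilon>} \<le> prob (?BF n) + prob (?BG n)" for n
    proof -
      have "prob {\<omega> \<in> space P. \<bar>elem (?H n) \<omega> - ?Z \<omega>\<bar> > \<epsilon>} \<le> prob (?BF n \<union> ?BG n)"
      proof (rule finite_measure_mono_AE)
        show "AE \<omega> in P. \<omega> \<in> {\<omega> \<in> space P. \<bar>elem (?H n) \<omega> - ?Z \<omega>\<bar> > \<epsilon>} \<longrightarrow> \<omega> \<in> ?BF n \<union> ?BG n"
          using elementary_lincomb(2)[OF F G, of a n b n]
        proof eventually_elim
          fix \<omega> assume eq: "elem (?H n) \<omega> = a * elem (F n) \<omega> + b * elem (G n) \<omega>"
          show "\<omega> \<in> {\<omega> \<in> space P. \<bar>elem (?H n) \<omega> - ?Z \<omega>\<bar> > \<epsilon>} \<longrightarrow> \<omega> \<in> ?BF n \<union> ?BG n"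
          proof (rule impI, rule ccontr)
            assume *: "\<omega> \<in> {\<omega> \<in> space P. \<bar>elem (?H n) \<omega> - ?Z \<omega>\<bar> > \<epsilon>}" and "\<omega> \<notin> ?BF n \<union> ?BG n"
            then have "\<bar>elem (F n) \<omega> - X \<omega>\<bar> \<le> \<delta>" "\<bar>elem (G n) \<omega> - Y \<omega>\<bar> \<le> \<delta>" by auto
            then have "\<bar>a\<bar> * \<bar>elem (F n) \<omega> - X \<omega>\<bar> + \<bar>b\<bar> * \<bar>elem (G n) \<omega> - Y \<omega>\<bar> \<le> \<bar>a\<bar> * \<delta> + \<bar>b\<bar> * \<delta>"
              by (intro add_mono mult_left_mono) auto
            moreover have "elem (?H n) \<omega> - ?Z \<omega> = a * (elem (F n) \<omega> - X \<omega>) + b * (elem (G n) \<omega> - Y \<omega>)"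
              unfolding eq by (simp add: algebra_simps)
            then have "\<bar>elem (?H n) \<omega> - ?Z \<omega>\<bar> \<le> \<bar>a\<bar> * \<bar>elem (F n) \<omega> - X \<omega>\<bar> + \<bar>b\<bar> * \<bar>elem (G n) \<omega> - Y \<omega>\<bar>"
              by (metis abs_mult abs_triangle_ineq)
            ultimately show False using * \<delta>2 by (simp add: distrib_right)
          qed
        qed
      qed measurable
      also have "\<dots> \<le> prob (?BF n) + prob (?BG n)"
        by (intro measure_Un_le) auto
      finally show ?thesis .
    qed
    then show "\<forall>\<^sub>F n in sequentially. prob {\<omega> \<in> space P. \<bar>elem (?H n) \<omega> - ?Z \<omega>\<bar> > \<epsilon>} \<le> prob (?BF n) + prob (?BG n)"
      by simp
    show "(\<lambda>n. prob (?BF n) + prob (?BG n)) \<longlonglongrightarrow> 0"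
      using tendsto_add[OF pF[OF \<delta>] pG[OF \<delta>]] by simp
  qed simp
  ultimately show ?thesis
    unfolding has_stable_integral_1_iff using H by (intro conjI exI[of _ ?H]) auto
qed

lemma has_stable_integral_sum:
  assumes "finite S" "\<And>t. t \<in> S \<Longrightarrow> has_stable_integral 1 P M (f t) (X t)"
  shows "has_stable_integral 1 P M (\<lambda>x. \<Sum>t\<in>S. c t * f t x) (\<lambda>\<omega>. \<Sum>t\<in>S. c t * X t \<omega>)"
  using assms
proof (induction S rule: finite_induct)
  case (insert t S)
  then show ?case
    using has_stable_integral_lincomb[of "f t" "X t" "\<lambda>x. \<Sum>t\<in>S. c t * f t x" "\<lambda>\<omega>. \<Sum>t\<in>S. c t * X t \<omega>" "c t" 1]
    by simp
qed (simp add: has_stable_integral_0)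

text \<open>
  Simple functions that converge pointwise to \<open>f\<close> and are bounded by \<open>2 |f|\<close> converge to \<open>f\<close> in \<open>L\<^sup>2\<close> by
  dominated convergence; their nonzero level sets have finite volume by Markov's inequality.
\<close>

lemma ex_elementary_approximation:
  assumes [measurable]: "f \<in> borel_measurable borel" and f2: "integrable lborel (\<lambda>x. (f x)\<^sup>2)"
  shows "\<exists>F. (\<forall>n. elementary_integrand (F n)) \<and> (\<lambda>n. \<integral>\<^sup>+x. ennreal ((F n x - f x)\<^sup>2) \<partial>(lborel :: 'e measure)) \<longlonglongrightarrow> 0"
proof -
  obtain F where F: "\<And>i. simple_function borel (F i)" "\<And>x. (\<lambda>i. F i x) \<longlonglongrightarrow> f x"
    "\<And>i x. dist (F i x) 0 \<le> 2 * dist (f x) 0"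
    using borel_measurable_implies_sequence_metric[OF assms(1), of 0] by auto
  have [measurable]: "F n \<in> borel_measurable borel" for n
    using F(1) by (rule borel_measurable_simple_function)
  have bound: "\<bar>F i x\<bar> \<le> 2 * \<bar>f x\<bar>" for i x using F(3)[of i x] by simp
  have fin: "(\<integral>\<^sup>+x. ennreal ((f x)\<^sup>2) \<partial>lborel) < \<infinity>"
    using f2 by (simp add: integrable_iff_bounded)
  have "elementary_integrand (F n)" for n
    unfolding elementary_integrand_def
  proof
    let ?R = "range (F n) - {0}"
    have R: "finite ?R" using simple_functionD(1)[OF F(1)] by auto
    have fib: "F n -` {y} \<in> sets lborel" for y
      using measurable_sets[of "F n" borel borel "{y}"] by simp
    have "emeasure lborel (F n -` {y}) < \<infinity>" if "y \<in> ?R" for y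
    proof -
      have "ennreal (y\<^sup>2) * emeasure lborel (F n -` {y}) = (\<integral>\<^sup>+x. ennreal (y\<^sup>2) * indicator (F n -` {y}) x \<partial>lborel)"
        using fib by (simp add: nn_integral_cmult_indicator)
      also have "\<dots> \<le> (\<integral>\<^sup>+x. ennreal 4 * ennreal ((f x)\<^sup>2) \<partial>lborel)"
      proof (rule nn_integral_mono)
        fix x
        have "(F n x)\<^sup>2 \<le> 4 * (f x)\<^sup>2"
          using power_mono[OF bound[of n x], of 2] by (simp add: power_mult_distrib)
        then have "ennreal ((F n x)\<^sup>2) \<le> ennreal 4 * ennreal ((f x)\<^sup>2)"
          by (subst ennreal_mult[symmetric]) (auto intro: ennreal_leI)
        then show "ennreal (y\<^sup>2) * indicator (F n -` {y}) x \<le> ennreal 4 * ennreal ((f x)\<^sup>2)"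
          by (auto simp: indicator_def)
      qed
      also have "\<dots> < \<infinity>"
        using fin by (subst nn_integral_cmult) (auto simp: ennreal_mult_less_top)
      finally show ?thesis
        using that by (auto simp: ennreal_mult_less_top)
    qed
    then have "(\<Sum>y\<in>?R. emeasure lborel (F n -` {y})) < \<infinity>"
      using R by simp
    moreover have "{x. F n x \<noteq> 0} = (\<Union>y\<in>?R. F n -` {y})" by auto
    ultimately show "emeasure lborel {x. F n x \<noteq> 0} < \<infinity>"
      using emeasure_subadditive_finite[OF R, of "\<lambda>y. F n -` {y}" lborel] fib by (auto intro: order_le_less_trans)
  qed (rule F(1))
  moreover have "(\<lambda>n. \<integral>\<^sup>+x. ennreal ((F n x - f x)\<^sup>2) \<partial>lborel) \<longlonglongrightarrow> (\<integral>\<^sup>+x. 0 \<partial>(lborel :: 'e measure))"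
  proof (rule nn_integral_dominated_convergence[where w="\<lambda>x. ennreal 9 * ennreal ((f x)\<^sup>2)"])
    show "AE x in lborel. ennreal ((F n x - f x)\<^sup>2) \<le> ennreal 9 * ennreal ((f x)\<^sup>2)" for n
    proof (rule AE_I2)
      fix x
      have "\<bar>F n x - f x\<bar> \<le> 3 * \<bar>f x\<bar>" using bound[of n x] by linarith
      then have "(F n x - f x)\<^sup>2 \<le> 9 * (f x)\<^sup>2"
        using power_mono[of "\<bar>F n x - f x\<bar>" "3 * \<bar>f x\<bar>" 2] by (simp add: power_mult_distrib)
      then show "ennreal ((F n x - f x)\<^sup>2) \<le> ennreal 9 * ennreal ((f x)\<^sup>2)"
        by (subst ennreal_mult[symmetric]) (auto intro: ennreal_leI)
    qed
    show "(\<integral>\<^sup>+x. ennreal 9 * ennreal ((f x)\<^sup>2) \<partial>lborel) < \<infinity>"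
      using fin by (subst nn_integral_cmult) (auto simp: ennreal_mult_less_top)
    show "AE x in lborel. (\<lambda>n. ennreal ((F n x - f x)\<^sup>2)) \<longlonglongrightarrow> 0"
    proof (rule AE_I2)
      fix x
      have "(\<lambda>n. (F n x - f x)\<^sup>2) \<longlonglongrightarrow> (f x - f x)\<^sup>2" by (intro tendsto_intros F)
      then show "(\<lambda>n. ennreal ((F n x - f x)\<^sup>2)) \<longlonglongrightarrow> 0"
        using tendsto_ennrealI by fastforce
    qed
  qed auto
  ultimately show ?thesis by auto
qed

lemma elementary_diff:
  assumes F: "elementary_integrand F" and G: "elementary_integrand G"
  shows "integrable P (\<lambda>\<omega>. (elem F \<omega> - elem G \<omega>)\<^sup>2)"
    and "expectation (\<lambda>\<omega>. (elem F \<omega> - elem G \<omega>)\<^sup>2) = 2 * (\<integral>x. (F x - G x)\<^sup>2 \<partial>lborel)"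
proof -
  let ?H = "\<lambda>x. 1 * F x + (- 1) * G x"
  have H: "elementary_integrand ?H" by (rule elementary_lincomb(1)[OF F G])
  have m: "elem ?H \<in> borel_measurable P" "elem F \<in> borel_measurable P" "elem G \<in> borel_measurable P"
    using F G H by (auto intro: borel_measurable_elementary_integral)
  have nn: "0 \<le> (\<integral>x. (?H x)\<^sup>2 \<partial>lborel)" by simp
  note gauss = gaussian_of_char[OF m(1) nn char_elementary_integral[OF H]]
  have ae: "AE \<omega> in P. (elem ?H \<omega>)\<^sup>2 = (elem F \<omega> - elem G \<omega>)\<^sup>2"
    using elementary_lincomb(2)[OF F G, of 1 "-1"] by eventually_elim simp
  show "integrable P (\<lambda>\<omega>. (elem F \<omega> - elem G \<omega>)\<^sup>2)"
    using gauss(3) m by (subst integrable_cong_AE[OF _ _ ae, symmetric]) auto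
  show "expectation (\<lambda>\<omega>. (elem F \<omega> - elem G \<omega>)\<^sup>2) = 2 * (\<integral>x. (F x - G x)\<^sup>2 \<partial>lborel)"
    using gauss(4) m by (subst integral_cong_AE[OF _ _ ae, symmetric]) auto
qed

text \<open>
  The \<open>L\<^sup>2\<close> norm of an elementary integral is \<open>sqrt 2\<close> times that of its integrand, so the elementary integrals of an approximating
  sequence are Cauchy in \<open>L\<^sup>1\<close>. A subsequence then converges almost surely, hence in probability.
\<close>

lemma ex_has_stable_integral:
  assumes [measurable]: "f \<in> borel_measurable borel" and f2: "integrable lborel (\<lambda>x. (f x)\<^sup>2)"
  shows "\<exists>X. has_stable_integral 1 P M f X"
proof -
  obtain F where F: "\<And>n. elementary_integrand (F n)"
    and L2: "(\<lambda>n. \<integral>\<^sup>+x. ennreal ((F n x - f x)\<^sup>2) \<partial>lborel) \<longlonglongrightarrow> 0"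
    using ex_elementary_approximation[OF assms] by auto
  have [measurable]: "elem (F n) \<in> borel_measurable P" for n
    by (rule borel_measurable_elementary_integral[OF F])
  have [measurable]: "F n \<in> borel_measurable borel" for n
    by (rule elementary_borel[OF F])
  have intF: "integrable P (elem (F n))" for n
  proof -
    have "integrable P (\<lambda>\<omega>. (elem (F n) \<omega>)\<^sup>2)"
      by (rule gaussian_of_char(3)[OF _ _ char_elementary_integral[OF F]]) auto
    then show ?thesis by (rule square_integrable_imp_integrable[rotated]) auto
  qed
  have cauchy: "\<exists>N. \<forall>i\<ge>N. \<forall>j\<ge>N. (\<integral>\<omega>. norm (elem (F i) \<omega> - elem (F j) \<omega>) \<partial>P) < e" if e: "0 < e" for e
  proof -
    \<comment> \<open>Then the squared distance of F i and F j is below e^2 / 2 for large i and j, and the variance of the difference below e^2.\<close>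
    have "\<forall>\<^sub>F n in sequentially. (\<integral>\<^sup>+x. ennreal ((F n x - f x)\<^sup>2) \<partial>lborel) < ennreal (e\<^sup>2 / 8)"
      by (rule order_tendstoD(2)[OF L2]) (use e in simp)
    then obtain N where N: "\<And>n. N \<le> n \<Longrightarrow> (\<integral>\<^sup>+x. ennreal ((F n x - f x)\<^sup>2) \<partial>lborel) < ennreal (e\<^sup>2 / 8)"
      by (auto simp: eventually_sequentially)
    have "(\<integral>\<omega>. norm (elem (F i) \<omega> - elem (F j) \<omega>) \<partial>P) < e" if ij: "N \<le> i" "N \<le> j" for i j
    proof -
      have d: "integrable lborel (\<lambda>x. (F n x - f x)\<^sup>2)" "(\<integral>x. (F n x - f x)\<^sup>2 \<partial>lborel) < e\<^sup>2 / 8" if "N \<le> n" for n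
      proof -
        show i: "integrable lborel (\<lambda>x. (F n x - f x)\<^sup>2)"
          using N[OF that] by (intro integrableI_nonneg) (auto intro: less_trans)
        show "(\<integral>x. (F n x - f x)\<^sup>2 \<partial>lborel) < e\<^sup>2 / 8"
          using N[OF that] by (subst (asm) nn_integral_eq_integral[OF i]) (auto simp: ennreal_less_iff)
      qed
      let ?v = "\<integral>x. (F i x - F j x)\<^sup>2 \<partial>lborel"
      have "?v \<le> (\<integral>x. 2 * (F i x - f x)\<^sup>2 + 2 * (F j x - f x)\<^sup>2 \<partial>lborel)"
      proof (rule integral_mono_AE')
        show "integrable lborel (\<lambda>x. 2 * (F i x - f x)\<^sup>2 + 2 * (F j x - f x)\<^sup>2)"
          using d ij by auto
        show "AE x in lborel. (F i x - F j x)\<^sup>2 \<le> 2 * (F i x - f x)\<^sup>2 + 2 * (F j x - f x)\<^sup>2"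
        proof (rule AE_I2)
          fix x
          show "(F i x - F j x)\<^sup>2 \<le> 2 * (F i x - f x)\<^sup>2 + 2 * (F j x - f x)\<^sup>2"
            using square_le_double[of "F i x - f x" "f x - F j x"] by (simp add: power2_commute[of "f x"])
        qed
      qed simp
      also have "\<dots> = 2 * (\<integral>x. (F i x - f x)\<^sup>2 \<partial>lborel) + 2 * (\<integral>x. (F j x - f x)\<^sup>2 \<partial>lborel)"
        using d ij by simp
      also have "\<dots> < e\<^sup>2 / 2" using d(2)[OF ij(1)] d(2)[OF ij(2)] by linarith
      finally have v: "?v < e\<^sup>2 / 2" .
      let ?D = "\<lambda>\<omega>. elem (F i) \<omega> - elem (F j) \<omega>"
      have "(\<integral>\<omega>. norm (?D \<omega>) \<partial>P) \<le> (\<integral>\<omega>. e / 2 + 1 / (2 * e) * (?D \<omega>)\<^sup>2 \<partial>P)"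
      proof (rule integral_mono)
        fix \<omega>
        \<comment> \<open>The first moment is controlled by the second through |D| <= e / 2 + D^2 / (2 e).\<close>
        have "0 \<le> (\<bar>?D \<omega>\<bar> - e)\<^sup>2 / (2 * e)" using e by simp
        then show "norm (?D \<omega>) \<le> e / 2 + 1 / (2 * e) * (?D \<omega>)\<^sup>2"
          using e by (simp add: power2_diff field_simps power2_eq_square)
      next
        show "integrable P (\<lambda>\<omega>. norm (?D \<omega>))" using intF by auto
        show "integrable P (\<lambda>\<omega>. e / 2 + 1 / (2 * e) * (?D \<omega>)\<^sup>2)"
          by (intro Bochner_Integration.integrable_add integrable_mult_right elementary_diff(1) F) simp
      qed
      also have "\<dots> = e / 2 + 1 / (2 * e) * (2 * ?v)"
        using elementary_diff[OF F F, of i j] by (subst Bochner_Integration.integral_add) (auto simp: prob_space)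
      also have "\<dots> < e / 2 + 1 / (2 * e) * (2 * (e\<^sup>2 / 2))"
        using v e by (intro add_strict_left_mono mult_strict_left_mono) auto
      also have "\<dots> = e" using e by (simp add: power2_eq_square)
      finally show ?thesis .
    qed
    then show ?thesis by blast
  qed
  obtain r where r: "strict_mono r" and c: "AE \<omega> in P. Cauchy (\<lambda>i. elem (F (r i)) \<omega>)"
    using cauchy_L1_AE_cauchy_subseq[of P "\<lambda>n. elem (F n)", OF intF cauchy] by blast
  define X where "X \<omega> = lim (\<lambda>i. elem (F (r i)) \<omega>)" for \<omega>
  have [measurable]: "X \<in> borel_measurable P"
    unfolding X_def by measurable
  have lim: "AE \<omega> in P. (\<lambda>i. elem (F (r i)) \<omega>) \<longlonglongrightarrow> X \<omega>"
    using c by eventually_elim (simp add: X_def Cauchy_convergent_iff convergent_LIMSEQ_iff)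
  have "(\<lambda>n. prob {\<omega> \<in> space P. \<bar>elem (F (r n)) \<omega> - X \<omega>\<bar> > \<epsilon>}) \<longlonglongrightarrow> 0" if \<epsilon>: "0 < \<epsilon>" for \<epsilon>
  proof -
    let ?B = "\<lambda>n. {\<omega> \<in> space P. \<bar>elem (F (r n)) \<omega> - X \<omega>\<bar> > \<epsilon>}"
    have "(\<lambda>n. \<integral>\<omega>. indicator (?B n) \<omega> \<partial>P) \<longlonglongrightarrow> (\<integral>\<omega>. (0::real) \<partial>P)"
    proof (rule integral_dominated_convergence[where w="\<lambda>_. 1"])
      show "AE \<omega> in P. (\<lambda>n. indicator (?B n) \<omega>) \<longlonglongrightarrow> (0::real)"
        using lim
      proof eventually_elim
        fix \<omega> assume "(\<lambda>i. elem (F (r i)) \<omega>) \<longlonglongrightarrow> X \<omega>"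
        then have "\<forall>\<^sub>F n in sequentially. dist (elem (F (r n)) \<omega>) (X \<omega>) < \<epsilon>"
          using \<epsilon> by (rule tendstoD)
        then have "\<forall>\<^sub>F n in sequentially. indicator (?B n) \<omega> = (0::real)"
          by eventually_elim (auto simp: dist_real_def)
        then show "(\<lambda>n. indicator (?B n) \<omega>) \<longlonglongrightarrow> (0::real)"
          by (rule tendsto_eventually)
      qed
    qed (auto simp: indicator_def)
    then show ?thesis by simp
  qed
  moreover have "(\<lambda>n. \<integral>\<^sup>+x. ennreal ((F (r n) x - f x)\<^sup>2) \<partial>lborel) \<longlonglongrightarrow> 0"
    using LIMSEQ_subseq_LIMSEQ[OF L2 r] by (simp add: o_def)
  ultimately have "has_stable_integral 1 P M f X"
    unfolding has_stable_integral_1_iff using F by (intro conjI exI[of _ "\<lambda>n. F (r n)"]) auto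
  then show ?thesis by blast
qed

end

section \<open>Covariance of the process\<close>

theorem proposition2p5:
  fixes \<alpha> \<beta> d :: real
    and p :: "real \<Rightarrow> 'a::euclidean_space \<Rightarrow> real"
    and P :: "'w measure"
    and M :: "(real \<times> 'a) set \<Rightarrow> 'w \<Rightarrow> real"
    and \<xi> :: "real \<Rightarrow> 'w \<Rightarrow> real"
  assumes "d = real DIM('a)"
    and "0 < \<alpha>" and "\<alpha> \<le> 2" and "\<beta> = 1" and "d < 2 * \<alpha>"
    and "stable_transition_density \<alpha> p"
    and "stable_random_measure \<beta> P M"
    and "\<And>t. 0 \<le> t \<Longrightarrow> \<xi> t \<in> borel_measurable P"
    and "\<And>t. 0 \<le> t \<Longrightarrow> AE \<omega> in P. \<xi> t \<omega> = stable_integral \<beta> P M (xi_kernel p t) \<omega>"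
  shows "centered_gaussian_process P {0..} \<xi> \<and>
    (\<forall>s\<ge>0. \<forall>t\<ge>0.
      (d \<noteq> \<alpha> \<longrightarrow>
        prob_space.expectation P (\<lambda>\<omega>. \<xi> s \<omega> * \<xi> t \<omega>) =
          2 * (p 1 0 / ((1 - d / \<alpha>) * (2 - d / \<alpha>) * (3 - d / \<alpha>)) *
            (1 / 2 * ((s + t) powr (3 - d / \<alpha>) + \<bar>s - t\<bar> powr (3 - d / \<alpha>))
              - s powr (3 - d / \<alpha>) - t powr (3 - d / \<alpha>)))) \<and>
      (d = \<alpha> \<longrightarrow>
        prob_space.expectation P (\<lambda>\<omega>. \<xi> s \<omega> * \<xi> t \<omega>) =
          2 * (p 1 0 / 2 *
            (1 / 2 * ((s + t)\<^sup>2 * ln (s + t) + (s - t)\<^sup>2 * ln \<bar>s - t\<bar>)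
              - s\<^sup>2 * ln s - t\<^sup>2 * ln t))))"
proof -
  interpret stable_density \<alpha> p
    using assms(2,6) by unfold_locales
  interpret gaussian_random_measure P M
    using assms(4,7) by unfold_locales simp
  let ?\<gamma> = "d / \<alpha>"
  have \<gamma>: "?\<gamma> < 2" using assms(2,5) by (simp add: field_simps)
  obtain \<phi>1 \<phi>2 \<phi>3 where prim: "iterated_primitives (\<lambda>x. x powr - (real DIM('a) / \<alpha>)) \<phi>1 \<phi>2 \<phi>3"
    and \<phi>3: "d \<noteq> \<alpha> \<Longrightarrow> \<phi>3 = (\<lambda>x. x powr (3 - ?\<gamma>) / ((1 - ?\<gamma>) * (2 - ?\<gamma>) * (3 - ?\<gamma>)))"
      "d = \<alpha> \<Longrightarrow> \<phi>3 = (\<lambda>x. x\<^sup>2 / 2 * ln x - 3 / 4 * x\<^sup>2)"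
  proof (cases "d = \<alpha>")
    case True
    then have "real DIM('a) / \<alpha> = 1" using assms(1,2) by simp
    with True iterated_primitives_ln show ?thesis by (intro that) auto
  next
    case False
    then have "?\<gamma> \<noteq> 1" using assms(2) by simp
    with False iterated_primitives_powr[OF \<gamma>] show ?thesis by (intro that) (auto simp: assms(1))
  qed
  let ?V = "\<lambda>s t. p 1 0 * (1 / 2 * (\<phi>3 (s + t) + \<phi>3 \<bar>s - t\<bar>) - \<phi>3 s - \<phi>3 t)"
  have inner: "has_bochner_integral lborel (\<lambda>y. xi_kernel p s y * xi_kernel p t y) (?V s t)"
    if "0 \<le> s" "0 \<le> t" for s t
    by (rule xi_kernel_inner[OF prim that])
  \<comment> \<open>The chosen integral exists because the kernel is square integrable.\<close>
  have int: "has_stable_integral 1 P M (xi_kernel p t) (\<xi> t)" if t: "0 \<le> t" for t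
  proof -
    have "integrable lborel (\<lambda>y. (xi_kernel p t y)\<^sup>2)"
      using integrable.intros[OF inner[OF t t]] by (simp add: power2_eq_square)
    then have "has_stable_integral 1 P M (xi_kernel p t) (stable_integral 1 P M (xi_kernel p t))"
      unfolding stable_integral_def by (rule someI_ex[OF ex_has_stable_integral[OF borel_measurable_xi_kernel]])
    then show ?thesis
      by (rule has_stable_integral_AE_cong) (use assms(4) assms(8,9)[OF t] in auto)
  qed
  have gauss: "gaussian_variable P X" "expectation X = 0" "integrable P (\<lambda>\<omega>. (X \<omega>)\<^sup>2)"
      "expectation (\<lambda>\<omega>. (X \<omega>)\<^sup>2) = 2 * (\<integral>y. (f y)\<^sup>2 \<partial>lborel)"
    if X: "has_stable_integral 1 P M f X" for f X
  proof -
    have m: "X \<in> borel_measurable P" using X by (simp add: has_stable_integral_def)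
    have nn: "0 \<le> (\<integral>y. (f y)\<^sup>2 \<partial>lborel)" by simp
    note g = gaussian_of_char[OF m nn has_stable_integral_char(2)[OF X]]
    show "gaussian_variable P X" "expectation X = 0" "integrable P (\<lambda>\<omega>. (X \<omega>)\<^sup>2)"
      "expectation (\<lambda>\<omega>. (X \<omega>)\<^sup>2) = 2 * (\<integral>y. (f y)\<^sup>2 \<partial>lborel)"
      by (rule g)+
  qed
  have process: "centered_gaussian_process P {0..} \<xi>"
    unfolding centered_gaussian_process_def
  proof (intro conjI allI impI ballI)
    fix S :: "real set" and c :: "real \<Rightarrow> real"
    assume "finite S" "S \<subseteq> {0..}"
    then show "gaussian_variable P (\<lambda>\<omega>. \<Sum>t\<in>S. c t * \<xi> t \<omega>)"
      by (intro gauss(1)[OF has_stable_integral_sum[where f="xi_kernel p"]] int) auto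
  next
    fix t :: real assume "t \<in> {0..}"
    then show "expectation (\<xi> t) = 0" by (intro gauss(2)[OF int]) auto
  qed
  have cov: "expectation (\<lambda>\<omega>. \<xi> s \<omega> * \<xi> t \<omega>) = 2 * ?V s t" if st: "0 \<le> s" "0 \<le> t" for s t
  proof -
    let ?k = "xi_kernel p"
    note plus = has_stable_integral_lincomb[OF int[OF st(1)] int[OF st(2)], of 1 1, simplified]
    note minus = has_stable_integral_lincomb[OF int[OF st(1)] int[OF st(2)], of 1 "-1", simplified]
    \<comment> \<open>Polarization: only second moments of single stable integrals are needed.\<close>
    have "expectation (\<lambda>\<omega>. \<xi> s \<omega> * \<xi> t \<omega>) = expectation (\<lambda>\<omega>. ((\<xi> s \<omega> + \<xi> t \<omega>)\<^sup>2 - (\<xi> s \<omega> - \<xi> t \<omega>)\<^sup>2) / 4)"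
      by (intro Bochner_Integration.integral_cong refl) (simp add: power2_eq_square algebra_simps)
    also have "\<dots> = (2 * (\<integral>y. (?k s y + ?k t y)\<^sup>2 \<partial>lborel) - 2 * (\<integral>y. (?k s y - ?k t y)\<^sup>2 \<partial>lborel)) / 4"
      using gauss(3,4)[OF plus] gauss(3,4)[OF minus] by simp
    also have "\<dots> = 2 * (\<integral>y. ((?k s y + ?k t y)\<^sup>2 - (?k s y - ?k t y)\<^sup>2) / 4 \<partial>lborel)"
      using has_stable_integral_char(1)[OF plus] has_stable_integral_char(1)[OF minus] by simp
    also have "(\<integral>y. ((?k s y + ?k t y)\<^sup>2 - (?k s y - ?k t y)\<^sup>2) / 4 \<partial>lborel) = (\<integral>y. ?k s y * ?k t y \<partial>lborel)"
      by (intro Bochner_Integration.integral_cong refl) (simp add: power2_eq_square algebra_simps)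
    also have "\<dots> = ?V s t"
      by (rule has_bochner_integral_integral_eq[OF inner[OF st]])
    finally show ?thesis .
  qed
  show ?thesis
  proof (intro conjI allI impI process)
    fix s t :: real assume st: "0 \<le> s" "0 \<le> t"
    show "expectation (\<lambda>\<omega>. \<xi> s \<omega> * \<xi> t \<omega>) =
          2 * (p 1 0 / ((1 - d / \<alpha>) * (2 - d / \<alpha>) * (3 - d / \<alpha>)) *
            (1 / 2 * ((s + t) powr (3 - d / \<alpha>) + \<bar>s - t\<bar> powr (3 - d / \<alpha>))
              - s powr (3 - d / \<alpha>) - t powr (3 - d / \<alpha>)))" if "d \<noteq> \<alpha>"
    proof -
      have *: "c * (1 / 2 * (a / K + b / K) - x / K - y / K) = c / K * (1 / 2 * (a + b) - x - y)" for a b x y c K :: real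
        by (simp add: diff_divide_distrib add_divide_distrib algebra_simps)
      show ?thesis unfolding cov[OF st] \<phi>3(1)[OF that] * ..
    qed
    show "expectation (\<lambda>\<omega>. \<xi> s \<omega> * \<xi> t \<omega>) =
          2 * (p 1 0 / 2 *
            (1 / 2 * ((s + t)\<^sup>2 * ln (s + t) + (s - t)\<^sup>2 * ln \<bar>s - t\<bar>)
              - s\<^sup>2 * ln s - t\<^sup>2 * ln t))" if "d = \<alpha>"
      unfolding cov[OF st] \<phi>3(2)[OF that] power2_abs by (simp add: power2_eq_square field_simps)
  qed
qed

end
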